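(* Let $N\ge 1$, let $\gamma_1,\gamma_2,V_1,V_2>0$ and $a_{i,j}\ge 0$ for $i,j=1,\dots,N$, and consider the networked system $$\dot x_{1,i}=-\gamma_1x_{1,i}+V_1g_2(x_{2,i})+\sum_{j=1}^N a_{i,j}(x_{1,j}-x_{1,i}),\qquad \dot x_{2,i}=-\gamma_2x_{2,i}+V_2g_1(x_{1,i}),\qquad i=1,\dots,N,$$ on the state space $\mathcal B^N$. Assume that the functions $g_1,g_2:\mathbb R_{\ge0}\to\mathbb R_{\ge0}$ are Lipschitz continuous, are either both monotonically increasing or both monotonically decreasing, and that at least one of them is bounded. Assume also that $a_{i,j}=a_{j,i}$ for all $i,j=1,\dots,N$. Then for every initial condition $\xi\in\mathcal B^N$ the $\omega$-limit set $\omega(\xi)$ contains only equilibria of the networked system. If moreover the equilibria of the networked system are isolated, then for every initial condition in $\mathcal B^N$ the corresponding solution $x(t)$ satisfies $\lim_{t\to+\infty}x(t)=\bar x$, where $\bar x$ is an equilibrium of the networked system.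
   Context: "Monotonically increasing (decreasing)" means non-decreasing (non-increasing); strict monotonicity is not required. The state space is $\mathcal B^N=\prod_{i=1}^N\mathcal B$, where $\mathcal B=[0,\bar x_1]\times[0,\bar x_2]$ with $\bar x_1,\bar x_2>0$ is a box that is forward invariant for the single-compartment dynamics $\dot x_1=-\gamma_1x_1+V_1g_2(x_2)$, $\dot x_2=-\gamma_2x_2+V_2g_1(x_1)$; the $i$-th factor $\mathcal B$ contains $(x_{1,i},x_{2,i})$. The set $\mathcal B^N$ is then forward invariant for the networked system. *)

theory Defs
  imports "HOL-Analysis.Analysis"
begin

section \<open>Autonomous differential equations on a set\<close>

text \<open>A solution of x' = f x on the time interval J is required to stay in X, the set on
  which the vector field is meaningful; the derivative is one-sided at the end points of J.\<close>

definition solution_on ::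
    "('a::real_normed_vector \<Rightarrow> 'a) \<Rightarrow> 'a set \<Rightarrow> real set \<Rightarrow> (real \<Rightarrow> 'a) \<Rightarrow> bool" where
  "solution_on f X J x \<longleftrightarrow>
     (\<forall>t\<in>J. x t \<in> X \<and> (x has_vector_derivative f (x t)) (at t within J))"

definition forward_invariant ::
    "('a::real_normed_vector \<Rightarrow> 'a) \<Rightarrow> 'a set \<Rightarrow> 'a set \<Rightarrow> bool" where
  "forward_invariant f X S \<longleftrightarrow> S \<subseteq> X \<and>
     (\<forall>T>0. \<forall>x. solution_on f X {0..T} x \<and> x 0 \<in> S \<longrightarrow> (\<forall>t\<in>{0..T}. x t \<in> S))"

text \<open>``x is the solution of the initial value problem'': x is a solution for all forward
  times, and every other one, even if it only exists on a bounded time interval, agrees with it.\<close>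

definition is_the_solution ::
    "('a::real_normed_vector \<Rightarrow> 'a) \<Rightarrow> 'a set \<Rightarrow> 'a \<Rightarrow> (real \<Rightarrow> 'a) \<Rightarrow> bool" where
  "is_the_solution f X \<xi> x \<longleftrightarrow> solution_on f X {0..} x \<and> x 0 = \<xi> \<and>
     (\<forall>T>0. \<forall>y. solution_on f X {0..T} y \<and> y 0 = \<xi> \<longrightarrow> (\<forall>t\<in>{0..T}. y t = x t))"

definition omega_limit_set :: "(real \<Rightarrow> 'a::topological_space) \<Rightarrow> 'a set" where
  "omega_limit_set x =
     {p. \<exists>\<tau>::nat \<Rightarrow> real. filterlim \<tau> at_top sequentially \<and> (\<lambda>k. x (\<tau> k)) \<longlonglongrightarrow> p}"

definition equilibria :: "('a::zero \<Rightarrow> 'a) \<Rightarrow> 'a set \<Rightarrow> 'a set" where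
  "equilibria f S = {p \<in> S. f p = 0}"

section \<open>The single compartment and the network\<close>

definition compartment_field ::
    "real \<Rightarrow> real \<Rightarrow> real \<Rightarrow> real \<Rightarrow> (real \<Rightarrow> real) \<Rightarrow> (real \<Rightarrow> real) \<Rightarrow> real \<times> real \<Rightarrow> real \<times> real" where
  "compartment_field \<gamma>1 \<gamma>2 V1 V2 g1 g2 p =
     (- \<gamma>1 * fst p + V1 * g2 (snd p), - \<gamma>2 * snd p + V2 * g1 (fst p))"

text \<open>A network state x consists of the pairs x $ i of the two concentrations in compartment i;
  the number N of compartments is the cardinality of the (finite, nonempty) index type.\<close>

definition network_field ::
    "real \<Rightarrow> real \<Rightarrow> real \<Rightarrow> real \<Rightarrow> (real \<Rightarrow> real) \<Rightarrow> (real \<Rightarrow> real) \<Rightarrow> ('n \<Rightarrow> 'n \<Rightarrow> real) \<Rightarrow>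
       (real \<times> real) ^ 'n::finite \<Rightarrow> (real \<times> real) ^ 'n" where
  "network_field \<gamma>1 \<gamma>2 V1 V2 g1 g2 a x =
     (\<chi> i. (- \<gamma>1 * fst (x $ i) + V1 * g2 (snd (x $ i))
              + (\<Sum>j\<in>UNIV. a i j * (fst (x $ j) - fst (x $ i))),
            - \<gamma>2 * snd (x $ i) + V2 * g1 (fst (x $ i))))"

text \<open>g1 and g2 are functions on the nonnegative reals only, so the vector fields live on
  the nonnegative quadrant and on its power.\<close>

definition quadrant :: "(real \<times> real) set" where
  "quadrant = {0..} \<times> {0..}"

definition state_box :: "real \<Rightarrow> real \<Rightarrow> (real \<times> real) set" where
  "state_box b1 b2 = {0..b1} \<times> {0..b2}"

definition set_power :: "'a set \<Rightarrow> ('a ^ 'n::finite) set" where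
  "set_power S = {x. \<forall>i. x $ i \<in> S}"

end

theory Submission
  imports Defs
begin

text \<open>
  Write \<open>u i\<close>, \<open>v i\<close> for the two concentrations in compartment \<open>i\<close>. The theorem is true because the
  network has a Lyapunov function that controls the rates of the \<open>u i\<close>, and the \<open>v i\<close> follow
  the \<open>u i\<close> through a stable linear filter.

  The equation for \<open>u\<close> is, for frozen \<open>v\<close>, the gradient flow of
  \<open>Q u - V1 * (\<Sum>i. u i * g2 (v i))\<close>, where \<open>Q\<close> is the convex quadratic form \<open>coupling_energy\<close>; this
  is where the symmetry of the coupling enters. The motion of \<open>v\<close> is compensated by a storage term:
  let \<open>\<phi> s = g2 (V2 / \<gamma>2 * g1 s)\<close>, which is increasing whether \<open>g1\<close>, \<open>g2\<close> both increase or both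
  decrease, let \<open>\<Phi>\<close> be a (convex) antiderivative of \<open>\<phi>\<close> and \<open>\<Psi>\<close> its Legendre conjugate over \<open>[0, b1]\<close>.
  Put
    \<open>W = Q u + V1 * (\<Sum>i. \<Psi> (g2 (v i)) - u i * g2 (v i))\<close>.
  If \<open>g2\<close> were differentiable, \<open>v i\<close> would contribute \<open>V1 * (h i - u i) * (d/dt) g2 (v i)\<close> with \<open>h i\<close> a
  point at which \<open>\<phi>\<close> passes the value \<open>g2 (v i)\<close>; monotonicity makes this product nonpositive, because
  the sign of \<open>v i'\<close> tells on which side of \<open>h i\<close> the value \<open>u i\<close> lies. So \<open>W' \<le> - |u'|\<^sup>2\<close>.

  Since \<open>g1\<close>, \<open>g2\<close> are only Lipschitz, derivatives are avoided throughout: solutions have uniform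
  second-order expansions (\<open>solution_second_order\<close>), and the dissipation inequality is
  proved as \<open>W t - W s \<le> - (t - s) * |u' t|\<^sup>2 + c * (t - s)\<^sup>2\<close> in \<open>first_rates_vanish\<close>. Such an
  inequality makes \<open>W\<close> decrease and forces \<open>u' \<longlongrightarrow> 0\<close> (\<open>dissipation_rate_vanishes\<close>); then \<open>v' \<longlongrightarrow> 0\<close>
  by \<open>stable_recursion_vanishes\<close>. Hence the vector field tends to zero along every trajectory,
  which by continuity turns limit points into equilibria. If equilibria are isolated, a small sphere around a limit point contains none, so the
  trajectory eventually cannot cross it and converges (\<open>converges_if_equilibria_isolated\<close>).

  Existence of solutions comes from Banach's fixed point theorem applied to the vector field
  precomposed with the projection to the box. That the network field points inwards on the faces of
  the box follows from the invariance of the box for one compartment, since the coupling terms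
  have the right sign on the faces.
\<close>

section \<open>Solutions of differential equations in boxes\<close>

lemma integral_from_zero_has_derivative:
  fixes h :: "real \<Rightarrow> 'a::banach"
  assumes "continuous_on {0..} h" "t \<ge> 0"
  shows "((\<lambda>u. integral {0..u} h) has_vector_derivative h t) (at t within {0..})"
proof -
  have "((\<lambda>u. integral {0..u} h) has_vector_derivative h t) (at t within {0..t+1})"
    by (rule integral_has_vector_derivative)
      (use assms in \<open>auto intro: continuous_on_subset\<close>)
  moreover have "at t within {0..t+1} = at t within {0..}"
    by (rule at_within_nhd[of t "{..<t+1}"]) auto
  ultimately show ?thesis by simp
qed

text \<open>Picard iteration on the whole half-line at once: \<open>y t = exp (- K * t) *\<^sub>R x t\<close> with \<open>K > L\<close> turns
  the integral equation for \<open>x\<close> into a fixed point equation in the bounded continuous functions,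
  where the exponential weight makes the operator a contraction of factor \<open>L / K\<close>. Boundedness of
  \<open>F\<close> keeps the operator inside that space.\<close>

lemma global_solution_exists:
  fixes F :: "'a::banach \<Rightarrow> 'a"
  assumes lip: "L-lipschitz_on UNIV F" and bdd: "\<And>x. norm (F x) \<le> M"
  shows "\<exists>x. solution_on F UNIV {0..} x \<and> x 0 = \<xi>"
proof -
  define K where "K = L + 1"
  have L: "L \<ge> 0" using lip by (rule lipschitz_on_nonneg)
  then have K: "K > 0" "L < K" by (auto simp: K_def)
  have M: "M \<ge> 0" using bdd[of undefined] norm_ge_zero order_trans by blast
  define h where "h y s = F (exp (K * s) *\<^sub>R y s)" for y and s :: real
  \<comment> \<open>The operator is extended to negative times by freezing it at time 0.\<close>
  define c where "c t = max 0 t" for t :: real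
  define G where "G y t = exp (- K * c t) *\<^sub>R (\<xi> + integral {0..c t} (h y))" for y t
  have contF: "continuous_on UNIV F" using lip by (rule lipschitz_on_continuous_on)
  have conth: "continuous_on A (h y)" if "continuous_on UNIV y" for y and A :: "real set"
    unfolding h_def
    by (rule continuous_on_compose2[OF contF])
      (auto intro!: continuous_intros continuous_on_subset[OF that])
  have inth: "h y integrable_on {0..t}" if "continuous_on UNIV y" for y and t :: real
    by (intro integrable_continuous_real conth that)
  have contG: "continuous_on UNIV (G y)" if y: "continuous_on UNIV y" for y
  proof -
    have "continuous_on {0..} (\<lambda>u. integral {0..u} (h y))"
      using integral_from_zero_has_derivative[OF conth[OF y]]
      by (auto simp: continuous_on_eq_continuous_within intro: has_vector_derivative_continuous)
    then have "continuous_on UNIV (\<lambda>t. integral {0..c t} (h y))"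
      by (rule continuous_on_compose2) (auto simp: c_def intro!: continuous_intros)
    then show ?thesis unfolding G_def by (intro continuous_intros) (auto simp: c_def intro!: continuous_intros)
  qed
  have c0: "c t \<ge> 0" for t by (simp add: c_def)
  have normG: "norm (G y t) \<le> norm \<xi> + M / K" if y: "continuous_on UNIV y" for y t
  proof -
    have "norm (integral {0..c t} (h y)) \<le> M * (c t - 0)"
      by (rule integral_bound) (auto simp: c0 h_def bdd intro!: conth[unfolded h_def] y)
    then have I: "norm (\<xi> + integral {0..c t} (h y)) \<le> norm \<xi> + M * c t"
      using norm_triangle_ineq[of \<xi> "integral {0..c t} (h y)"] by simp
    have e: "exp (- K * c t) * c t \<le> 1 / K"
    proof -
      have "K * c t \<le> exp (K * c t)" using exp_ge_add_one_self[of "K * c t"] by linarith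
      then show ?thesis using K by (simp add: exp_minus field_simps)
    qed
    have "norm (G y t) \<le> exp (- K * c t) * (norm \<xi> + M * c t)"
      unfolding G_def using I by simp
    also have "\<dots> = exp (- K * c t) * norm \<xi> + M * (exp (- K * c t) * c t)"
      by (simp add: algebra_simps)
    also have "\<dots> \<le> 1 * norm \<xi> + M * (1 / K)"
      using K c0[of t] M e by (intro add_mono mult_right_mono mult_left_mono) auto
    finally show ?thesis by simp
  qed
  have G_bc: "G y \<in> bcontfun" if "continuous_on UNIV y" for y
    using contG[OF that] normG[OF that] by (rule bcontfun_normI)
  define H where "H y = Bcontfun (G (apply_bcontfun y))" for y
  have H: "apply_bcontfun (H y) = G (apply_bcontfun y)" for y
    unfolding H_def using G_bc[OF continuous_on_apply_bcontfun] by (simp add: Bcontfun_inverse)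
  have contr: "dist (H y) (H z) \<le> L / K * dist y z" for y z
  proof (rule dist_bound)
    fix t
    have cy: "continuous_on UNIV (apply_bcontfun y)" "continuous_on UNIV (apply_bcontfun z)"
      by simp_all
    let ?D = "dist y z"
    have p: "norm (h y s - h z s) \<le> L * ?D * exp (K * s)" for s
    proof -
      have "norm (h y s - h z s) \<le> L * norm (exp (K * s) *\<^sub>R y s - exp (K * s) *\<^sub>R z s)"
        unfolding h_def using lipschitz_onD[OF lip] by (simp add: dist_norm)
      also have "norm (exp (K * s) *\<^sub>R y s - exp (K * s) *\<^sub>R z s) = exp (K * s) * dist (y s) (z s)"
        by (simp add: dist_norm flip: scaleR_diff_right)
      also have "L * (exp (K * s) * dist (y s) (z s)) \<le> L * (exp (K * s) * ?D)"
        using L by (intro mult_left_mono dist_bounded) auto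
      finally show ?thesis by (simp add: algebra_simps)
    qed
    have I: "((\<lambda>s. L * ?D * exp (K * s)) has_integral
          (L * ?D / K * exp (K * c t) - L * ?D / K * exp (K * 0))) {0..c t}"
      by (rule fundamental_theorem_of_calculus)
        (use K in \<open>auto simp: c0 simp flip: has_real_derivative_iff_has_vector_derivative
          intro!: derivative_eq_intros\<close>)
    have "norm (integral {0..c t} (h y) - integral {0..c t} (h z)) =
        norm (integral {0..c t} (\<lambda>s. h y s - h z s))"
      using inth[OF cy(1)] inth[OF cy(2)] by (simp add: integral_diff)
    also have "\<dots> \<le> integral {0..c t} (\<lambda>s. L * ?D * exp (K * s))"
      using inth[OF cy(1)] inth[OF cy(2)] I p
      by (intro integral_norm_bound_integral) (auto intro: integrable_diff)
    also have "\<dots> = L * ?D / K * exp (K * c t) - L * ?D / K * exp (K * 0)"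
      by (rule integral_unique[OF I])
    also have "\<dots> \<le> L * ?D / K * exp (K * c t)"
      using K L by simp
    finally have J: "norm (integral {0..c t} (h y) - integral {0..c t} (h z)) \<le> L * ?D / K * exp (K * c t)" .
    have "dist (G y t) (G z t) =
        exp (- K * c t) * norm (integral {0..c t} (h y) - integral {0..c t} (h z))"
      unfolding G_def dist_norm by (simp flip: scaleR_diff_right)
    also have "\<dots> \<le> exp (- K * c t) * (L * ?D / K * exp (K * c t))"
      using J by (intro mult_left_mono) auto
    also have "\<dots> = L / K * ?D" by (simp add: exp_minus)
    finally show "dist (H y t) (H z t) \<le> L / K * ?D" by (simp add: H)
  qed
  have "\<exists>!y. H y = y"
    by (rule banach_fix_type[of "L / K"]) (use K L contr in auto)
  then obtain y where y: "H y = y" by blast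
  have cy: "continuous_on UNIV (apply_bcontfun y)" by simp
  define x where "x t = exp (K * t) *\<^sub>R y t" for t
  have xe: "x t = \<xi> + integral {0..t} (h y)" if "t \<ge> 0" for t
  proof -
    have "y t = G y t" using H[of y] y by simp
    then show ?thesis using that by (simp add: x_def G_def c_def flip: exp_add)
  qed
  have "(x has_vector_derivative F (x t)) (at t within {0..})" if t: "t \<ge> 0" for t
  proof -
    have "((\<lambda>t. \<xi> + integral {0..t} (h y)) has_vector_derivative h y t) (at t within {0..})"
      using has_vector_derivative_add[OF has_vector_derivative_const[of \<xi>]
          integral_from_zero_has_derivative[OF conth[OF cy] t]] by simp
    then have "(x has_vector_derivative h y t) (at t within {0..})"
      by (rule has_vector_derivative_transform[rotated 2]) (use t xe in auto)
    then show ?thesis by (simp add: h_def x_def)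
  qed
  moreover have "x 0 = \<xi>" using xe[of 0] by simp
  ultimately show ?thesis unfolding solution_on_def by auto
qed

text \<open>To exceed \<open>c\<close> the function would have to grow after the last time at which it is below \<open>c\<close>,
  but its derivative is nonpositive from then on.\<close>

lemma stays_below_threshold:
  fixes \<phi> :: "real \<Rightarrow> real"
  assumes d: "\<And>t. t \<ge> 0 \<Longrightarrow> (\<phi> has_real_derivative \<phi>' t) (at t within {0..})"
    and 0: "\<phi> 0 \<le> c" and neg: "\<And>t. t \<ge> 0 \<Longrightarrow> \<phi> t > c \<Longrightarrow> \<phi>' t \<le> 0"
    and T: "T \<ge> 0"
  shows "\<phi> T \<le> c"
proof (rule ccontr)
  assume *: "\<not> \<phi> T \<le> c"
  have cont: "continuous_on {0..T} \<phi>"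
    using d by (force simp: continuous_on_eq_continuous_within
        intro: continuous_within_subset DERIV_continuous)
  have "compact ({0..T} \<inter> \<phi> -` {..c})"
    unfolding compact_eq_bounded_closed
    by (auto intro!: continuous_closed_preimage cont bounded_Int)
  moreover have "0 \<in> {0..T} \<inter> \<phi> -` {..c}" using 0 T by auto
  ultimately obtain s where s: "s \<in> {0..T} \<inter> \<phi> -` {..c}"
    and max: "\<And>r. r \<in> {0..T} \<inter> \<phi> -` {..c} \<Longrightarrow> r \<le> s"
    using compact_attains_sup[of "{0..T} \<inter> \<phi> -` {..c}"] by blast
  have "s \<noteq> T" using * s by auto
  with s have sT: "s < T" "0 \<le> s" by auto
  have "\<exists>x\<in>{s<..<T}. \<phi> T - \<phi> s = (\<lambda>h. \<phi>' x * h) (T - s)"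
  proof (rule mvt_simple[OF sT(1)])
    fix r assume "s \<le> r" "r \<le> T"
    then show "(\<phi> has_derivative (\<lambda>h. \<phi>' r * h)) (at r within {s..T})"
      using d[of r] sT by (auto simp: has_field_derivative_def intro: has_derivative_subset)
  qed
  then obtain r where r: "s < r" "r < T" and e: "\<phi> T - \<phi> s = \<phi>' r * (T - s)" by auto
  have "\<phi> r > c" using max[of r] r sT by force
  then have "\<phi>' r \<le> 0" using neg[of r] r sT by auto
  then have "\<phi> T \<le> \<phi> s" using e sT by (smt (verit) mult_nonpos_nonneg)
  with * s show False by auto
qed

lemma solution_on_mono:
  assumes "solution_on f S J x" "S \<subseteq> X" "I \<subseteq> J"
  shows "solution_on f X I x"
  using assms unfolding solution_on_def by (blast intro: has_vector_derivative_within_subset)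

lemma solution_component:
  fixes f :: "'a::euclidean_space \<Rightarrow> 'a"
  assumes "solution_on f X J x" "t \<in> J"
  shows "((\<lambda>t. x t \<bullet> i) has_real_derivative f (x t) \<bullet> i) (at t within J)"
  using assms bounded_linear.has_vector_derivative[OF bounded_linear_inner_left[of i]]
  unfolding solution_on_def has_real_derivative_iff_has_vector_derivative by blast

text \<open>A version of Nagumo's invariance theorem. Precomposing with the projection \<open>clamp\<close> gives a
  bounded field on the whole space; a coordinate outside its range is seen by that field as lying
  on the corresponding face, where the field points inwards, so no coordinate ever leaves its range
  and the projection is invisible to the solution.\<close>

lemma box_solution_exists:
  fixes f :: "'a::euclidean_space \<Rightarrow> 'a"
  assumes lip: "L-lipschitz_on (cbox a b) f"
    and low: "\<And>p i. p \<in> cbox a b \<Longrightarrow> i \<in> Basis \<Longrightarrow> p \<bullet> i = a \<bullet> i \<Longrightarrow> f p \<bullet> i \<ge> 0"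
    and high: "\<And>p i. p \<in> cbox a b \<Longrightarrow> i \<in> Basis \<Longrightarrow> p \<bullet> i = b \<bullet> i \<Longrightarrow> f p \<bullet> i \<le> 0"
    and \<xi>: "\<xi> \<in> cbox a b"
  shows "\<exists>x. solution_on f (cbox a b) {0..} x \<and> x 0 = \<xi>"
proof -
  define F where "F p = f (clamp a b p)" for p
  have ab: "a \<bullet> i \<le> b \<bullet> i" if "i \<in> Basis" for i
    using \<xi> that by (force simp: mem_box)
  have cl: "clamp a b p \<in> cbox a b" for p using ab by simp
  have "L-lipschitz_on UNIV F"
  proof (rule lipschitz_onI)
    fix p q
    have "dist (F p) (F q) \<le> L * dist (clamp a b p) (clamp a b q)"
      unfolding F_def using lipschitz_onD[OF lip cl cl] .
    also have "\<dots> \<le> L * dist p q"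
      by (intro mult_left_mono dist_clamps_le_dist_args lipschitz_on_nonneg[OF lip])
    finally show "dist (F p) (F q) \<le> L * dist p q" .
  qed (rule lipschitz_on_nonneg[OF lip])
  moreover have "bounded (f ` cbox a b)"
    by (intro compact_imp_bounded compact_continuous_image compact_cbox
        lipschitz_on_continuous_on[OF lip])
  then obtain M where "\<And>p. p \<in> cbox a b \<Longrightarrow> norm (f p) \<le> M"
    unfolding bounded_iff by auto
  then have "norm (F p) \<le> M" for p unfolding F_def using cl by blast
  ultimately obtain x where x: "solution_on F UNIV {0..} x" "x 0 = \<xi>"
    using global_solution_exists by blast
  have clamp_i: "clamp a b p \<bullet> i = (if p \<bullet> i < a \<bullet> i then a \<bullet> i else if p \<bullet> i \<le> b \<bullet> i then p \<bullet> i else b \<bullet> i)"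
    if "i \<in> Basis" for p i
    using that ab unfolding clamp_def by auto
  have inbox: "x t \<in> cbox a b" if t: "t \<ge> 0" for t
    unfolding mem_box
  proof (intro ballI conjI)
    fix i :: 'a assume i: "i \<in> Basis"
    have d: "((\<lambda>t. x t \<bullet> i) has_real_derivative F (x t) \<bullet> i) (at t within {0..})" if "t \<ge> 0" for t
      using solution_component[OF x(1)] that by simp
    show "x t \<bullet> i \<le> b \<bullet> i"
    proof (rule stays_below_threshold[OF d _ _ t])
      show "x 0 \<bullet> i \<le> b \<bullet> i" using x \<xi> i by (auto simp: mem_box)
      fix t assume "x t \<bullet> i > b \<bullet> i"
      then show "F (x t) \<bullet> i \<le> 0"
        unfolding F_def using cl i ab[OF i] by (intro high) (auto simp: clamp_i)
    qed
    have "- (x t \<bullet> i) \<le> - (a \<bullet> i)"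
    proof (rule stays_below_threshold[OF DERIV_minus[OF d] _ _ t])
      show "- (x 0 \<bullet> i) \<le> - (a \<bullet> i)" using x \<xi> i by (auto simp: mem_box)
      fix t assume "- (x t \<bullet> i) > - (a \<bullet> i)"
      then show "- (F (x t) \<bullet> i) \<le> 0"
        unfolding F_def using cl i low[of "clamp a b (x t)" i] by (auto simp: clamp_i)
    qed
    then show "a \<bullet> i \<le> x t \<bullet> i" by simp
  qed
  have "solution_on f (cbox a b) {0..} x"
    using x(1) inbox unfolding solution_on_def F_def by auto
  with x(2) show ?thesis by blast
qed

text \<open>Gronwall's argument: \<open>exp (- 2 * L * s) * |x s - y s|\<^sup>2\<close> is nonincreasing.\<close>

lemma solutions_unique:
  fixes f :: "'a::euclidean_space \<Rightarrow> 'a"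
  assumes lip: "L-lipschitz_on X f"
    and x: "solution_on f X {0..T} x" and y: "solution_on f X {0..T} y" and eq: "x 0 = y 0"
    and t: "t \<in> {0..T}"
  shows "x t = y t"
proof -
  define w where "w s = x s - y s" for s
  define \<phi> where "\<phi> s = exp (- 2 * L * s) * (w s \<bullet> w s)" for s
  define D where "D s = exp (- 2 * L * s) * (2 * (w s \<bullet> (f (x s) - f (y s))) - 2 * L * (w s \<bullet> w s))" for s
  have dw: "(w has_vector_derivative (f (x s) - f (y s))) (at s within {0..t})" if s: "s \<in> {0..t}" for s
    unfolding w_def
    using solution_on_mono[OF x subset_refl, of "{0..t}"] solution_on_mono[OF y subset_refl, of "{0..t}"] t s
    unfolding solution_on_def by (intro has_vector_derivative_diff) auto
  have d\<phi>: "(\<phi> has_real_derivative D s) (at s within {0..t})" if s: "s \<in> {0..t}" for s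
  proof -
    have "((\<lambda>s. w s \<bullet> w s) has_derivative
        (\<lambda>h. w s \<bullet> (h *\<^sub>R (f (x s) - f (y s))) + (h *\<^sub>R (f (x s) - f (y s))) \<bullet> w s)) (at s within {0..t})"
      using dw[OF s] unfolding has_vector_derivative_def
      by (rule has_derivative_inner[OF _ dw[OF s, unfolded has_vector_derivative_def]])
    moreover have "(\<lambda>h. w s \<bullet> (h *\<^sub>R (f (x s) - f (y s))) + (h *\<^sub>R (f (x s) - f (y s))) \<bullet> w s)
        = (*) (2 * (w s \<bullet> (f (x s) - f (y s))))"
      by (auto simp: inner_commute algebra_simps fun_eq_iff)
    ultimately have "((\<lambda>s. w s \<bullet> w s) has_real_derivative 2 * (w s \<bullet> (f (x s) - f (y s)))) (at s within {0..t})"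
      unfolding has_field_derivative_def by simp
    then show ?thesis unfolding \<phi>_def D_def
      by (auto intro!: derivative_eq_intros simp: algebra_simps)
  qed
  have Dneg: "D s \<le> 0" if s: "s \<in> {0..t}" for s
  proof -
    have "w s \<bullet> (f (x s) - f (y s)) \<le> norm (w s) * norm (f (x s) - f (y s))"
      by (rule norm_cauchy_schwarz)
    also have "norm (f (x s) - f (y s)) \<le> L * norm (w s)"
      using lipschitz_onD[OF lip, of "x s" "y s"] x y s t
      unfolding solution_on_def w_def dist_norm by auto
    finally have "w s \<bullet> (f (x s) - f (y s)) \<le> norm (w s) * (L * norm (w s))"
      by (simp add: mult_left_mono)
    then have "w s \<bullet> (f (x s) - f (y s)) \<le> L * (w s \<bullet> w s)"
      by (simp add: dot_square_norm power2_eq_square mult_ac)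
    then show ?thesis unfolding D_def by (simp add: mult_nonneg_nonpos)
  qed
  have "\<phi> t \<le> \<phi> 0"
  proof (cases "t = 0")
    case False
    then have "0 < t" using t by auto
    then have "\<exists>s\<in>{0<..<t}. \<phi> t - \<phi> 0 = (\<lambda>h. D s * h) (t - 0)"
      using d\<phi> by (intro mvt_simple) (auto simp: has_field_derivative_def)
    then show ?thesis using Dneg \<open>0 < t\<close> by (smt (verit) atLeastAtMost_iff greaterThanLessThan_iff mult_nonpos_nonneg)
  qed simp
  also have "\<phi> 0 = 0" using eq by (simp add: \<phi>_def w_def)
  finally have "w t \<bullet> w t \<le> 0" by (simp add: \<phi>_def mult_le_0_iff)
  then have "w t = 0" using inner_ge_zero[of "w t"] by (metis order_antisym inner_eq_zero_iff)
  then show ?thesis by (simp add: w_def)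
qed

text \<open>A converse of \<open>box_solution_exists\<close>: a field pointing outwards at a point of a face carries the
  solution from that point out of the box.\<close>

lemma invariant_box_face:
  fixes f :: "'a::euclidean_space \<Rightarrow> 'a"
  assumes inv: "forward_invariant f X (cbox a b)"
    and sol: "solution_on f X {0..} x" "x 0 = p"
    and p: "p \<in> cbox a b" "i \<in> Basis" "p \<bullet> i = b \<bullet> i"
  shows "f p \<bullet> i \<le> 0"
proof (rule ccontr)
  assume "\<not> f p \<bullet> i \<le> 0"
  moreover have "((\<lambda>t. x t \<bullet> i) has_real_derivative f p \<bullet> i) (at 0 within {0..})"
    using solution_component[OF sol(1), of 0 i] sol(2) by simp
  ultimately obtain d where d: "d > 0" "\<And>h. h > 0 \<Longrightarrow> 0 + h \<in> {0..} \<Longrightarrow> h < d \<Longrightarrow> x 0 \<bullet> i < x (0 + h) \<bullet> i"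
    using has_real_derivative_pos_inc_right by (metis not_le)
  have "x (d / 2) \<in> cbox a b"
    using inv solution_on_mono[OF sol(1) subset_refl, of "{0..d}"] sol(2) p d(1)
    unfolding forward_invariant_def by fastforce
  then have "x (d / 2) \<bullet> i \<le> b \<bullet> i" using p by (auto simp: mem_box)
  with d(2)[of "d / 2"] d(1) sol(2) p(3) show False by simp
qed

text \<open>These estimates replace time derivatives of expressions that are only Lipschitz in the state.\<close>

lemma solution_second_order:
  fixes f :: "'a::real_normed_vector \<Rightarrow> 'a"
  assumes sol: "solution_on f S {0..} x" and lip: "L-lipschitz_on S f"
    and bdd: "\<And>p. p \<in> S \<Longrightarrow> norm (f p) \<le> M"
    and st: "0 \<le> s" "s \<le> t"
  shows "norm (x t - x s) \<le> M * (t - s)"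
    and "r \<in> {s..t} \<Longrightarrow> norm (x t - x s - (t - s) *\<^sub>R f (x r)) \<le> L * M * (t - s)\<^sup>2"
proof -
  have d: "(x has_derivative (\<lambda>h. h *\<^sub>R f (x q))) (at q within {p..p'})" if "0 \<le> p" "q \<in> {p..p'}" for p p' q
    using sol that unfolding solution_on_def has_vector_derivative_def
    by (auto intro: has_derivative_subset[of _ _ _ "{0..}"])
  have xS: "x q \<in> S" if "q \<ge> 0" for q using sol that unfolding solution_on_def by auto
  have M: "M \<ge> 0" using bdd[OF xS[OF st(1)]] norm_ge_zero order_trans by blast
  have incr: "norm (x q' - x q) \<le> M * (q' - q)" if "0 \<le> q" "q \<le> q'" for q q'
  proof -
    have "norm (x q' - x q) \<le> M * norm (q' - q)"
    proof (rule differentiable_bound[where S = "{q..q'}"])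
      show "onorm (\<lambda>h. h *\<^sub>R f (x y)) \<le> M" if "y \<in> {q..q'}" for y
        using that \<open>0 \<le> q\<close> M
        by (intro onorm_bound) (auto simp: mult.commute[of M] intro!: mult_left_mono bdd xS)
    qed (use that d in auto)
    then show ?thesis using that by simp
  qed
  show "norm (x t - x s) \<le> M * (t - s)" using incr st .
  assume r: "r \<in> {s..t}"
  have L: "L \<ge> 0" using lip by (rule lipschitz_on_nonneg)
  define h where "h q = x q - q *\<^sub>R f (x r)" for q
  have "norm (h t - h s) \<le> L * (M * (t - s)) * norm (t - s)"
  proof (rule differentiable_bound[where S = "{s..t}"])
    fix q assume q: "q \<in> {s..t}"
    show "(h has_derivative (\<lambda>k. k *\<^sub>R (f (x q) - f (x r)))) (at q within {s..t})"
      unfolding h_def using d[OF st(1) q]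
      by (auto intro!: derivative_eq_intros simp: scaleR_diff_right)
    have "norm (x q - x r) \<le> M * (t - s)"
    proof (cases "q \<le> r")
      case True
      then have "norm (x r - x q) \<le> M * (r - q)" using incr[of q r] q r st by auto
      also have "\<dots> \<le> M * (t - s)" using q r M by (intro mult_left_mono) auto
      finally show ?thesis by (simp add: norm_minus_commute)
    next
      case False
      then have "norm (x q - x r) \<le> M * (q - r)" using incr[of r q] q r st by auto
      also have "\<dots> \<le> M * (t - s)" using q r M by (intro mult_left_mono) auto
      finally show ?thesis .
    qed
    moreover have "norm (f (x q) - f (x r)) \<le> L * norm (x q - x r)"
      using lipschitz_onD[OF lip, of "x q" "x r"] q r st xS by (auto simp: dist_norm)
    ultimately have B: "norm (f (x q) - f (x r)) \<le> L * (M * (t - s))"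
      using L by (meson mult_left_mono order_trans)
    then show "onorm (\<lambda>k. k *\<^sub>R (f (x q) - f (x r))) \<le> L * (M * (t - s))"
      using L M st
      by (intro onorm_bound)
        (auto simp: mult.commute[of "L * (M * (t - s))"] intro!: mult_left_mono)
  qed (use st in auto)
  moreover have "h t - h s = x t - x s - (t - s) *\<^sub>R f (x r)"
    by (simp add: h_def algebra_simps)
  ultimately show "norm (x t - x s - (t - s) *\<^sub>R f (x r)) \<le> L * M * (t - s)\<^sup>2"
    using st by (simp add: power2_eq_square mult_ac)
qed

section \<open>Asymptotics from quadratic difference inequalities\<close>

text \<open>Summing the bound \<open>C * h\<^sup>2\<close> over ever finer subdivisions shows that \<open>W\<close> decreases, hence
  converges. Over a step of fixed length \<open>\<delta>\<close> the loss of \<open>W\<close> therefore tends to zero, which leaves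
  \<open>limsup d \<le> C * \<delta>\<close>. It serves as a substitute for Barbalat's lemma.\<close>

lemma dissipation_rate_vanishes:
  fixes W d :: "real \<Rightarrow> real"
  assumes step: "\<And>s t. 0 \<le> s \<Longrightarrow> s \<le> t \<Longrightarrow> W t - W s \<le> - (t - s) * d t + C * (t - s)\<^sup>2"
    and d: "\<And>t. 0 \<le> t \<Longrightarrow> 0 \<le> d t"
    and below: "\<And>t. 0 \<le> t \<Longrightarrow> m \<le> W t"
  shows "(d \<longlongrightarrow> 0) at_top"
proof -
  have quad: "W t - W s \<le> C * (t - s)\<^sup>2" if "0 \<le> s" "s \<le> t" for s t
    using step[OF that] d[of t] that by (smt (verit) mult_minus_left mult_nonneg_nonneg)
  have mono: "W t \<le> W s" if st: "0 \<le> s" "s \<le> t" for s t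
  proof (rule ccontr)
    assume "\<not> W t \<le> W s"
    then have pos: "W t - W s > 0" by simp
    obtain n :: nat where n: "C * (t - s)\<^sup>2 / (W t - W s) < real n"
      using reals_Archimedean2 by blast
    define h where "h = (t - s) / real (Suc n)"
    have h: "h \<ge> 0" using st by (simp add: h_def)
    have "W (s + real k * h) - W s \<le> real k * (C * h\<^sup>2)" for k
    proof (induction k)
      case (Suc k)
      have "W (s + real (Suc k) * h) - W (s + real k * h) \<le> C * h\<^sup>2"
        using quad[of "s + real k * h" "s + real (Suc k) * h"] st h by (simp add: algebra_simps)
      with Suc show ?case by (simp add: algebra_simps)
    qed simp
    from this[of "Suc n"] have "W t - W s \<le> real (Suc n) * (C * h\<^sup>2)"
      by (simp add: h_def del: of_nat_Suc)
    also have "\<dots> = C * (t - s)\<^sup>2 / real (Suc n)"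
      by (simp add: h_def power2_eq_square del: of_nat_Suc)
    finally have "real (Suc n) * (W t - W s) \<le> C * (t - s)\<^sup>2"
      by (simp add: field_simps del: of_nat_Suc)
    moreover have "C * (t - s)\<^sup>2 < real n * (W t - W s)"
      using n pos by (simp add: field_simps)
    ultimately show False using pos by (simp add: algebra_simps)
  qed
  define I where "I = Inf (W ` {0..})"
  have bb: "bdd_below (W ` {0..})" using below by (intro bdd_belowI2) auto
  show ?thesis
  proof (rule tendstoI)
    fix \<epsilon> :: real assume \<epsilon>: "\<epsilon> > 0"
    \<comment> \<open>Half of \<open>\<epsilon>\<close> is spent on the error \<open>C * \<delta>\<close>, half on the remaining loss of \<open>W\<close>.\<close>
    define \<delta> where "\<delta> = \<epsilon> / (2 * (\<bar>C\<bar> + 1))"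
    have \<delta>: "\<delta> > 0" using \<epsilon> by (simp add: \<delta>_def)
    have "C * \<delta> \<le> (\<bar>C\<bar> + 1) * \<delta>" using \<delta> by (intro mult_right_mono) auto
    also have "\<dots> = \<epsilon> / 2" by (simp add: \<delta>_def field_simps)
    finally have C\<delta>: "C * \<delta> \<le> \<epsilon> / 2" .
    have "\<exists>w\<in>W ` {0..}. w < I + \<delta> * (\<epsilon> / 2)"
      unfolding I_def by (rule cInf_lessD) (use \<delta> \<epsilon> in auto)
    then obtain T where T: "T \<ge> 0" "W T < I + \<delta> * (\<epsilon> / 2)" by auto
    have "dist (d t) 0 < \<epsilon>" if t: "t \<ge> T + \<delta>" for t
    proof -
      have "I \<le> W t" unfolding I_def using t T \<delta> bb by (intro cInf_lower) auto
      moreover have "W (t - \<delta>) \<le> W T" using t T by (intro mono) auto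
      moreover have "W t - W (t - \<delta>) \<le> - \<delta> * d t + C * \<delta>\<^sup>2"
        using step[of "t - \<delta>" t] t T \<delta> by simp
      moreover have "C * \<delta>\<^sup>2 \<le> \<delta> * (\<epsilon> / 2)"
        using mult_left_mono[OF C\<delta>, of \<delta>] \<delta> by (simp add: power2_eq_square mult_ac)
      ultimately have "\<delta> * d t < \<delta> * \<epsilon>" using T by simp
      then show ?thesis using \<delta> d[of t] t T by simp
    qed
    then show "\<forall>\<^sub>F t in at_top. dist (d t) 0 < \<epsilon>"
      unfolding eventually_at_top_linorder by blast
  qed
qed

text \<open>The recursion with step \<open>\<delta>\<close> is a contraction towards \<open>C * \<delta> / \<gamma>\<close>, and \<open>\<delta>\<close> is arbitrary.\<close>

lemma stable_recursion_vanishes: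
  fixes r :: "real \<Rightarrow> real"
  assumes \<gamma>: "\<gamma> > 0" and C: "C \<ge> 0"
    and r: "\<And>t. t \<ge> 0 \<Longrightarrow> 0 \<le> r t" "\<And>t. t \<ge> 0 \<Longrightarrow> r t \<le> B"
    and step: "\<And>\<delta>. 0 < \<delta> \<Longrightarrow> \<gamma> * \<delta> < 1 \<Longrightarrow>
      \<forall>\<^sub>F t in at_top. r (t + \<delta>) \<le> (1 - \<gamma> * \<delta>) * r t + C * \<delta>\<^sup>2"
  shows "(r \<longlongrightarrow> 0) at_top"
proof (rule tendstoI)
  fix \<epsilon> :: real assume \<epsilon>: "\<epsilon> > 0"
  define \<delta> where "\<delta> = min (1 / (2 * \<gamma>)) (\<epsilon> * \<gamma> / (2 * (C + 1)))"
  have \<delta>: "\<delta> > 0" using \<gamma> \<epsilon> C by (simp add: \<delta>_def)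
  have "\<gamma> * \<delta> \<le> \<gamma> * (1 / (2 * \<gamma>))" using \<gamma> by (intro mult_left_mono) (auto simp: \<delta>_def)
  then have \<gamma>\<delta>: "\<gamma> * \<delta> < 1" using \<gamma> by simp
  have "C * \<delta> \<le> (C + 1) * (\<epsilon> * \<gamma> / (2 * (C + 1)))"
    using C \<delta> by (intro mult_mono) (auto simp: \<delta>_def)
  also have "\<dots> = \<gamma> * (\<epsilon> / 2)" using C by (simp add: field_simps)
  finally have C\<delta>: "C * \<delta> / \<gamma> \<le> \<epsilon> / 2" using \<gamma> by (simp add: field_simps)
  define q where "q = 1 - \<gamma> * \<delta>"
  have q: "0 \<le> q" "q < 1" using \<gamma>\<delta> \<gamma> \<delta> by (auto simp: q_def)
  obtain T0 where T0: "\<And>t. t \<ge> T0 \<Longrightarrow> r (t + \<delta>) \<le> q * r t + C * \<delta>\<^sup>2"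
    using step[OF \<delta> \<gamma>\<delta>] unfolding eventually_at_top_linorder q_def by blast
  define T where "T = max 0 T0"
  have iter: "r (t + real n * \<delta>) \<le> q ^ n * B + C * \<delta> / \<gamma>" if t: "t \<ge> T" for t n
  proof (induction n)
    case 0
    then show ?case using r(2)[of t] t C \<delta> \<gamma> by (simp add: T_def add_increasing2)
  next
    case (Suc n)
    have "t + real n * \<delta> \<ge> T0" using t \<delta> by (simp add: T_def add_increasing2)
    from T0[OF this] have "r (t + real (Suc n) * \<delta>) \<le> q * r (t + real n * \<delta>) + C * \<delta>\<^sup>2"
      by (simp add: algebra_simps)
    also have "\<dots> \<le> q * (q ^ n * B + C * \<delta> / \<gamma>) + C * \<delta>\<^sup>2"
      using Suc q by (intro add_right_mono mult_left_mono)
    also have "\<dots> = q ^ Suc n * B + C * \<delta> / \<gamma>"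
      using \<gamma> by (simp add: q_def field_simps power2_eq_square)
    finally show ?case .
  qed
  have "(\<lambda>n. q ^ n * B) \<longlonglongrightarrow> 0 * B" by (intro tendsto_mult_right LIMSEQ_power_zero) (use q in auto)
  then have "\<forall>\<^sub>F n in sequentially. q ^ n * B < \<epsilon> / 2"
    using \<epsilon> by (intro order_tendstoD(2)[of _ 0]) auto
  then obtain n where n: "q ^ n * B < \<epsilon> / 2" unfolding eventually_sequentially by blast
  have "dist (r t) 0 < \<epsilon>" if t: "t \<ge> T + real n * \<delta>" for t
  proof -
    have "r t \<le> q ^ n * B + C * \<delta> / \<gamma>" using iter[of "t - real n * \<delta>" n] t by simp
    moreover have "t \<ge> 0" using t \<delta> by (smt (verit) T_def mult_nonneg_nonneg of_nat_0_le_iff)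
    ultimately have "r t < \<epsilon>" "0 \<le> r t" using n C\<delta> r(1)[of t] by linarith+
    then show ?thesis by simp
  qed
  then show "\<forall>\<^sub>F t in at_top. dist (r t) 0 < \<epsilon>"
    unfolding eventually_at_top_linorder by blast
qed

section \<open>Legendre conjugates and the coupling energy\<close>

text \<open>The function is \<open>\<Psi> y = (SUP s\<in>{0..b}. s * y - \<Phi> s)\<close> with \<open>\<Phi>\<close> an antiderivative of \<open>\<phi>\<close>. Its
  subgradient at \<open>z\<close> is any maximiser, a point where \<open>\<phi>\<close> passes the value \<open>z\<close> or an end point of the
  interval; the sign condition says that \<open>u\<close> lies on the side of that maximiser on which replacing it
  by \<open>u\<close> only increases its product with \<open>z - y\<close>.\<close>

lemma conjugate_exists:
  fixes \<phi> :: "real \<Rightarrow> real"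
  assumes b: "b \<ge> 0" and cont: "continuous_on {0..b} \<phi>" and mono: "mono_on {0..b} \<phi>"
  shows "\<exists>\<Psi>. (\<forall>y z. \<bar>\<Psi> z - \<Psi> y\<bar> \<le> b * \<bar>z - y\<bar>) \<and>
    (\<forall>u\<in>{0..b}. \<forall>y z. (\<phi> u - z) * (z - y) \<ge> 0 \<longrightarrow> \<Psi> z - \<Psi> y \<le> u * (z - y))"
proof -
  obtain \<Phi> where \<Phi>: "\<And>s. s \<in> {0..b} \<Longrightarrow> (\<Phi> has_vector_derivative \<phi> s) (at s within {0..b})"
    using antiderivative_continuous[OF cont] by metis
  have mv: "\<exists>c\<in>{s<..<s'}. \<Phi> s' - \<Phi> s = \<phi> c * (s' - s)" if "0 \<le> s" "s < s'" "s' \<le> b" for s s'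
  proof -
    have "\<exists>c\<in>{s<..<s'}. \<Phi> s' - \<Phi> s = (\<lambda>h. h *\<^sub>R \<phi> c) (s' - s)"
    proof (rule mvt_simple[OF that(2)])
      fix c assume "s \<le> c" "c \<le> s'"
      then have "(\<Phi> has_derivative (\<lambda>h. h *\<^sub>R \<phi> c)) (at c within {0..b})"
        using \<Phi>[of c] that by (simp add: has_vector_derivative_def)
      then show "(\<Phi> has_derivative (\<lambda>h. h *\<^sub>R \<phi> c)) (at c within {s..s'})"
        by (rule has_derivative_subset) (use that in auto)
    qed
    then show ?thesis by (simp add: mult.commute)
  qed
  have subgrad: "\<Phi> s - \<Phi> u \<ge> \<phi> u * (s - u)" if s: "s \<in> {0..b}" and u: "u \<in> {0..b}" for s u
  proof (cases s u rule: linorder_cases)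
    case less
    then obtain c where c: "c \<in> {s<..<u}" "\<Phi> u - \<Phi> s = \<phi> c * (u - s)" using mv[of s u] s u by auto
    have "\<phi> c * (u - s) \<le> \<phi> u * (u - s)"
      using c s u less by (intro mult_right_mono mono_onD[OF mono]) auto
    then show ?thesis using c by (simp add: algebra_simps)
  next
    case greater
    then obtain c where c: "c \<in> {u<..<s}" "\<Phi> s - \<Phi> u = \<phi> c * (s - u)" using mv[of u s] s u by auto
    have "\<phi> u * (s - u) \<le> \<phi> c * (s - u)"
      using c s u greater by (intro mult_right_mono mono_onD[OF mono]) auto
    then show ?thesis using c by simp
  qed simp
  define \<Psi> where "\<Psi> y = (SUP s\<in>{0..b}. s * y - \<Phi> s)" for y
  have cont\<Phi>: "continuous_on {0..b} \<Phi>"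
    using has_vector_derivative_continuous[OF \<Phi>] by (auto simp: continuous_on_eq_continuous_within)
  have bdd: "bdd_above ((\<lambda>s. s * y - \<Phi> s) ` {0..b})" for y
    by (intro bounded_imp_bdd_above compact_imp_bounded compact_continuous_image)
      (auto intro!: continuous_intros cont\<Phi>)
  have upper: "s * y - \<Phi> s \<le> \<Psi> y" if "s \<in> {0..b}" for s y
    unfolding \<Psi>_def using that bdd by (rule cSUP_upper)
  have least: "\<Psi> z \<le> \<Psi> y + c" if "\<And>s. s \<in> {0..b} \<Longrightarrow> s * z - \<Phi> s \<le> \<Psi> y + c" for y z c
    unfolding \<Psi>_def[of z] using that b by (intro cSUP_least) auto
  have lip: "\<Psi> z \<le> \<Psi> y + b * \<bar>z - y\<bar>" for y z
  proof (rule least)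
    fix s assume s: "s \<in> {0..b}"
    have "s * (z - y) \<le> s * \<bar>z - y\<bar>" using s by (intro mult_left_mono) auto
    also have "\<dots> \<le> b * \<bar>z - y\<bar>" using s by (intro mult_right_mono) auto
    finally show "s * z - \<Phi> s \<le> \<Psi> y + b * \<bar>z - y\<bar>"
      using upper[OF s, of y] by (simp add: algebra_simps)
  qed
  have \<Psi>_lip: "\<bar>\<Psi> z - \<Psi> y\<bar> \<le> b * \<bar>z - y\<bar>" for y z
  proof -
    have "\<Psi> y \<le> \<Psi> z + b * \<bar>z - y\<bar>" using lip[of y z] by (simp only: abs_minus_commute)
    with lip[of z y] lip[of y z] show ?thesis by linarith
  qed
  have \<Psi>_sub: "\<Psi> z - \<Psi> y \<le> u * (z - y)" if u: "u \<in> {0..b}" and sgn: "(\<phi> u - z) * (z - y) \<ge> 0" for u y z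
  proof -
    have "\<Psi> z \<le> \<Psi> y + u * (z - y)"
    proof (rule least)
      fix s assume s: "s \<in> {0..b}"
      show "s * z - \<Phi> s \<le> \<Psi> y + u * (z - y)"
      proof (cases "(s - u) * (z - y) \<le> 0")
        case True
        then show ?thesis using upper[OF s, of y] by (simp add: algebra_simps)
      next
        case False
        then have "(s - u) * (\<phi> u - z) \<ge> 0"
          using sgn by (auto simp: not_le zero_less_mult_iff zero_le_mult_iff)
        then have "s * z - \<Phi> s \<le> u * z - \<Phi> u"
          using subgrad[OF s u] by (simp add: algebra_simps)
        then show ?thesis using upper[OF u, of y] by (simp add: algebra_simps)
      qed
    qed
    then show ?thesis by simp
  qed
  show ?thesis
    by (intro exI[of _ \<Psi>] conjI allI ballI impI) (rule \<Psi>_lip, rule \<Psi>_sub)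
qed

definition coupling_energy :: "real \<Rightarrow> ('n::finite \<Rightarrow> 'n \<Rightarrow> real) \<Rightarrow> ('n \<Rightarrow> real) \<Rightarrow> real" where
  "coupling_energy \<gamma> a u =
     (\<Sum>i\<in>UNIV. \<gamma> / 2 * (u i)\<^sup>2 + (\<Sum>j\<in>UNIV. a i j / 4 * (u i - u j)\<^sup>2))"

text \<open>The energy is convex, and by symmetry of \<open>a\<close> its gradient is the decay plus diffusion term of
  the network.\<close>

lemma coupling_energy_subgradient:
  fixes a :: "'n::finite \<Rightarrow> 'n \<Rightarrow> real"
  assumes \<gamma>: "\<gamma> \<ge> 0" and a: "\<And>i j. a i j \<ge> 0" and sym: "\<And>i j. a i j = a j i"
  shows "coupling_energy \<gamma> a w - coupling_energy \<gamma> a u \<le>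
    (\<Sum>i\<in>UNIV. (\<gamma> * w i - (\<Sum>j\<in>UNIV. a i j * (w j - w i))) * (w i - u i))"
proof -
  define e where "e i = w i - u i" for i
  have sq: "p\<^sup>2 - q\<^sup>2 \<le> 2 * p * (p - q)" for p q :: real
    using zero_le_power2[of "p - q"] by (simp add: power2_eq_square algebra_simps)
  have "coupling_energy \<gamma> a w - coupling_energy \<gamma> a u =
      (\<Sum>i\<in>UNIV. \<gamma> / 2 * ((w i)\<^sup>2 - (u i)\<^sup>2) + (\<Sum>j\<in>UNIV. a i j / 4 * ((w i - w j)\<^sup>2 - (u i - u j)\<^sup>2)))"
    by (simp add: coupling_energy_def right_diff_distrib sum_subtractf algebra_simps)
  also have "\<dots> \<le> (\<Sum>i\<in>UNIV. \<gamma> / 2 * (2 * w i * (w i - u i)) +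
      (\<Sum>j\<in>UNIV. a i j / 4 * (2 * (w i - w j) * ((w i - w j) - (u i - u j)))))"
    using \<gamma> a by (intro sum_mono add_mono mult_left_mono sq) auto
  also have "\<dots> = (\<Sum>i\<in>UNIV. \<gamma> * w i * e i) +
      ((\<Sum>i\<in>UNIV. \<Sum>j\<in>UNIV. a i j * (w i - w j) * e i) - (\<Sum>i\<in>UNIV. \<Sum>j\<in>UNIV. a i j * (w i - w j) * e j)) / 2"
  proof -
    have "a i j / 4 * (2 * (w i - w j) * ((w i - w j) - (u i - u j))) =
        (a i j * (w i - w j) * e i - a i j * (w i - w j) * e j) / 2" for i j
      by (simp add: e_def field_simps)
    moreover have "\<gamma> / 2 * (2 * w i * (w i - u i)) = \<gamma> * w i * e i" for i
      by (simp add: e_def)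
    ultimately show ?thesis
      by (simp only: sum.distrib sum_subtractf sum_divide_distrib[symmetric])
  qed
  also have "(\<Sum>i\<in>UNIV. \<Sum>j\<in>UNIV. a i j * (w i - w j) * e j) =
      (\<Sum>i\<in>UNIV. \<Sum>j\<in>UNIV. a i j * (w j - w i) * e i)"
    by (subst sum.swap) (simp add: sym)
  also have "\<dots> = - (\<Sum>i\<in>UNIV. \<Sum>j\<in>UNIV. a i j * (w i - w j) * e i)"
    by (simp flip: sum_negf) (intro sum.cong refl, simp add: algebra_simps)
  finally have "coupling_energy \<gamma> a w - coupling_energy \<gamma> a u \<le>
      (\<Sum>i\<in>UNIV. \<gamma> * w i * e i + (\<Sum>j\<in>UNIV. a i j * (w i - w j) * e i))"
    by (simp add: sum.distrib)
  also have "\<dots> = (\<Sum>i\<in>UNIV. (\<gamma> * w i - (\<Sum>j\<in>UNIV. a i j * (w j - w i))) * (w i - u i))"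
  proof (rule sum.cong[OF refl])
    fix i
    have "(\<Sum>j\<in>UNIV. a i j * (w j - w i)) = - (\<Sum>j\<in>UNIV. a i j * (w i - w j))"
      by (simp add: algebra_simps flip: sum_negf)
    then show "\<gamma> * w i * e i + (\<Sum>j\<in>UNIV. a i j * (w i - w j) * e i) =
        (\<gamma> * w i - (\<Sum>j\<in>UNIV. a i j * (w j - w i))) * (w i - u i)"
      by (simp add: e_def distrib_right flip: sum_distrib_right)
  qed
  finally show ?thesis .
qed

section \<open>Limits of trajectories along which the vector field vanishes\<close>

lemma omega_limit_set_equilibria:
  fixes f :: "'a::real_normed_vector \<Rightarrow> 'a" and x :: "real \<Rightarrow> 'a"
  assumes S: "closed S" and cont: "continuous_on S f"
    and x: "\<And>t. t \<ge> 0 \<Longrightarrow> x t \<in> S" and lim: "((\<lambda>t. f (x t)) \<longlongrightarrow> 0) at_top"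
  shows "omega_limit_set x \<subseteq> equilibria f S"
proof
  fix p assume "p \<in> omega_limit_set x"
  then obtain \<tau> :: "nat \<Rightarrow> real" where \<tau>: "filterlim \<tau> at_top sequentially" and p: "(\<lambda>k. x (\<tau> k)) \<longlonglongrightarrow> p"
    unfolding omega_limit_set_def by blast
  have ev: "\<forall>\<^sub>F k in sequentially. x (\<tau> k) \<in> S"
    using eventually_compose_filterlim[OF eventually_ge_at_top[of 0] \<tau>]
    by eventually_elim (rule x)
  have pS: "p \<in> S" by (rule Lim_in_closed_set[OF S ev _ p]) simp
  have "(\<lambda>k. f (x (\<tau> k))) \<longlonglongrightarrow> f p"
    by (rule continuous_on_tendsto_compose[OF cont p pS ev])
  moreover have "(\<lambda>k. f (x (\<tau> k))) \<longlonglongrightarrow> 0" by (rule filterlim_compose[OF lim \<tau>])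
  ultimately have "f p = 0" by (rule LIMSEQ_unique)
  with pS show "p \<in> equilibria f S" by (simp add: equilibria_def)
qed

text \<open>Around a limit point \<open>p\<close> every small sphere is free of equilibria, so the norm of \<open>f\<close> has a
  positive minimum there. Once the field along the trajectory is smaller than that minimum, the
  trajectory cannot meet the sphere, and it is inside infinitely often.\<close>

lemma converges_if_equilibria_isolated:
  fixes f :: "'a::real_normed_vector \<Rightarrow> 'a" and x :: "real \<Rightarrow> 'a"
  assumes S: "compact S" and cont: "continuous_on S f"
    and x: "\<And>t. t \<ge> 0 \<Longrightarrow> x t \<in> S" and xcont: "continuous_on {0..} x"
    and lim: "((\<lambda>t. f (x t)) \<longlongrightarrow> 0) at_top"
    and iso: "\<forall>p\<in>equilibria f S. p isolated_in equilibria f S"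
  shows "\<exists>p\<in>equilibria f S. (x \<longlongrightarrow> p) at_top"
proof -
  obtain p and \<sigma> :: "nat \<Rightarrow> nat" where p: "p \<in> S" and \<sigma>: "strict_mono \<sigma>" and lp: "((\<lambda>n. x (real n)) \<circ> \<sigma>) \<longlonglongrightarrow> p"
    using S x unfolding compact_def by (metis of_nat_0_le_iff)
  have lims: "filterlim (\<lambda>n. real (\<sigma> n)) at_top sequentially"
    by (rule filterlim_compose[OF filterlim_real_sequentially filterlim_subseq[OF \<sigma>]])
  have "p \<in> omega_limit_set x"
    unfolding omega_limit_set_def using lims lp by (auto simp: o_def)
  then have pE: "p \<in> equilibria f S"
    using omega_limit_set_equilibria[OF compact_imp_closed[OF S] cont x lim] by blast
  obtain e where e: "e > 0" "\<And>q. q \<in> equilibria f S \<Longrightarrow> dist p q < e \<Longrightarrow> q = p"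
    using iso pE unfolding isolated_in_dist_Ex_iff by blast
  have "(x \<longlongrightarrow> p) at_top"
  proof (rule tendstoI)
    fix \<epsilon> :: real assume "\<epsilon> > 0"
    define \<eta> where "\<eta> = min \<epsilon> (e / 2)"
    have \<eta>: "\<eta> > 0" "\<eta> \<le> \<epsilon>" "\<eta> < e" using \<open>\<epsilon> > 0\<close> e(1) by (auto simp: \<eta>_def)
    let ?S = "S \<inter> sphere p \<eta>"
    have ne: "f q \<noteq> 0" if "q \<in> ?S" for q
      using that e(2)[of q] \<eta> by (auto simp: equilibria_def)
    have "\<exists>m>0. \<forall>q\<in>?S. m \<le> norm (f q)"
    proof (cases "?S = {}")
      case False
      have "closed (sphere p \<eta>)"
        unfolding sphere_def by (intro closed_Collect_eq continuous_intros)
      with S have "compact ?S" by (rule compact_Int_closed)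
      moreover have "continuous_on ?S (\<lambda>q. norm (f q))"
        by (intro continuous_intros continuous_on_subset[OF cont]) auto
      ultimately obtain q where "q \<in> ?S" "\<And>q'. q' \<in> ?S \<Longrightarrow> norm (f q) \<le> norm (f q')"
        using continuous_attains_inf[of ?S "\<lambda>q. norm (f q)"] False by blast
      then show ?thesis using ne by (intro exI[of _ "norm (f q)"]) auto
    qed (auto intro: exI[of _ 1])
    then obtain m where m: "m > 0" "\<And>q. q \<in> ?S \<Longrightarrow> m \<le> norm (f q)" by blast
    have "\<forall>\<^sub>F t in at_top. norm (f (x t)) < m"
      using tendstoD[OF lim m(1)] by (simp add: dist_norm)
    then obtain T0 where T0: "\<And>t. t \<ge> T0 \<Longrightarrow> norm (f (x t)) < m"
      unfolding eventually_at_top_linorder by blast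
    define T where "T = max 0 T0"
    have off: "dist p (x t) \<noteq> \<eta>" if "t \<ge> T" for t
      using m(2)[of "x t"] T0[of t] x[of t] that by (auto simp: T_def)
    have "\<forall>\<^sub>F n in sequentially. dist (x (real (\<sigma> n))) p < \<eta> \<and> real (\<sigma> n) \<ge> T"
      using tendstoD[OF lp \<eta>(1)] eventually_compose_filterlim[OF eventually_ge_at_top[of T] lims]
      by eventually_elim (auto simp: o_def)
    then obtain n where n: "dist (x (real (\<sigma> n))) p < \<eta>" "real (\<sigma> n) \<ge> T"
      using eventually_happens'[OF sequentially_bot] by blast
    have "dist (x t) p < \<eta>" if t: "t \<ge> real (\<sigma> n)" for t
    proof (rule ccontr)
      assume *: "\<not> dist (x t) p < \<eta>"
      have "\<exists>s. real (\<sigma> n) \<le> s \<and> s \<le> t \<and> dist p (x s) = \<eta>"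
      proof (rule IVT')
        show "continuous_on {real (\<sigma> n)..t} (\<lambda>s. dist p (x s))"
          using n(2) by (intro continuous_intros continuous_on_subset[OF xcont]) (auto simp: T_def)
      qed (use n * t in \<open>auto simp: dist_commute\<close>)
      then obtain s where "real (\<sigma> n) \<le> s" "dist p (x s) = \<eta>" by blast
      then show False using off[of s] n(2) by simp
    qed
    then show "\<forall>\<^sub>F t in at_top. dist (x t) p < \<epsilon>"
      unfolding eventually_at_top_linorder using \<eta>(2) by (meson less_le_trans)
  qed
  with pE show ?thesis by blast
qed

section \<open>The network of compartments\<close>

lemma mem_cbox_vec:
  fixes x a b :: "'a::euclidean_space ^ 'n::finite"
  shows "x \<in> cbox a b \<longleftrightarrow> (\<forall>i. x $ i \<in> cbox (a $ i) (b $ i))"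
  unfolding mem_box Basis_vec_def by (auto simp: inner_axis)

lemma state_box_cbox: "state_box b1 b2 = cbox (0, 0) (b1, b2)"
  by (simp add: state_box_def cbox_Pair_eq)

lemma set_power_state_box_cbox:
  "set_power (state_box b1 b2) = (cbox 0 (\<chi> i. (b1, b2)) :: ((real \<times> real) ^ 'n::finite) set)"
  by (simp add: set_power_def state_box_cbox mem_cbox_vec set_eq_iff flip: zero_prod_def)

lemma abs_component_le:
  fixes x :: "(real \<times> real) ^ 'n::finite"
  shows "\<bar>fst (x $ i)\<bar> \<le> norm x" "\<bar>snd (x $ i)\<bar> \<le> norm x"
proof -
  have "norm (fst (x $ i)) \<le> norm (x $ i)" "norm (snd (x $ i)) \<le> norm (x $ i)"
    using norm_fst_le[of "fst (x $ i)" "snd (x $ i)"] norm_snd_le[of "snd (x $ i)" "fst (x $ i)"]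
    by simp_all
  moreover have "norm (x $ i) \<le> norm x" by (rule Finite_Cartesian_Product.norm_nth_le)
  ultimately show "\<bar>fst (x $ i)\<bar> \<le> norm x" "\<bar>snd (x $ i)\<bar> \<le> norm x" by auto
qed

lemma norm_le_components:
  fixes x :: "(real \<times> real) ^ 'n::finite"
  assumes "\<And>i. \<bar>fst (x $ i)\<bar> \<le> c" "\<And>i. \<bar>snd (x $ i)\<bar> \<le> d"
  shows "norm x \<le> real CARD('n) * (c + d)"
proof -
  have "norm (x $ i) \<le> c + d" for i
    using norm_Pair_le[of "fst (x $ i)" "snd (x $ i)"] assms[of i] by auto
  then have "(\<Sum>i\<in>UNIV. norm (x $ i)) \<le> (\<Sum>i\<in>(UNIV::'n set). c + d)" by (intro sum_mono)
  moreover have "norm x \<le> (\<Sum>i\<in>UNIV. norm (x $ i))"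
    unfolding norm_vec_def by (rule L2_set_le_sum) auto
  ultimately show ?thesis by simp
qed

lemma linear_increment:
  fixes c V \<kappa> d :: real
  assumes "c \<ge> 0" "V \<ge> 0" "\<bar>p - q\<bar> \<le> d" "\<bar>g - h\<bar> \<le> \<kappa> * d"
  shows "\<bar>(- c * p + V * g) - (- c * q + V * h)\<bar> \<le> (c + V * \<kappa>) * d"
proof -
  have "(- c * p + V * g) - (- c * q + V * h) = V * (g - h) - c * (p - q)"
    by (simp add: algebra_simps)
  moreover have "\<bar>V * (g - h)\<bar> \<le> V * (\<kappa> * d)" "\<bar>c * (p - q)\<bar> \<le> c * d"
    using assms by (auto simp: abs_mult intro!: mult_left_mono)
  ultimately show ?thesis by (simp add: algebra_simps)
qed

locale compartmental_network =
  fixes \<gamma>1 \<gamma>2 V1 V2 b1 b2 \<kappa>1 \<kappa>2 :: real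
    and g1 g2 :: "real \<Rightarrow> real"
    and a :: "'n::finite \<Rightarrow> 'n \<Rightarrow> real"
  assumes pos: "\<gamma>1 > 0" "\<gamma>2 > 0" "V1 > 0" "V2 > 0" "b1 > 0" "b2 > 0"
    and a_nonneg: "\<And>i j. a i j \<ge> 0"
    and g_nonneg: "\<And>s. s \<ge> 0 \<Longrightarrow> g1 s \<ge> 0" "\<And>s. s \<ge> 0 \<Longrightarrow> g2 s \<ge> 0"
    and g_lipschitz: "\<kappa>1-lipschitz_on {0..} g1" "\<kappa>2-lipschitz_on {0..} g2"
    and g_monotone: "(mono_on {0..} g1 \<and> mono_on {0..} g2) \<or> (antimono_on {0..} g1 \<and> antimono_on {0..} g2)"
    and g_bounded: "bounded (g1 ` {0..}) \<or> bounded (g2 ` {0..})"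
    and box_invariant: "forward_invariant (compartment_field \<gamma>1 \<gamma>2 V1 V2 g1 g2) quadrant (state_box b1 b2)"
    and a_sym: "\<And>i j. a i j = a j i"
begin

abbreviation "compartment \<equiv> compartment_field \<gamma>1 \<gamma>2 V1 V2 g1 g2"
abbreviation "network \<equiv> network_field \<gamma>1 \<gamma>2 V1 V2 g1 g2 a"
abbreviation orthant :: "((real \<times> real) ^ 'n) set" where "orthant \<equiv> set_power quadrant"
abbreviation box_power :: "((real \<times> real) ^ 'n) set" where "box_power \<equiv> set_power (state_box b1 b2)"

lemma \<kappa>_nonneg: "\<kappa>1 \<ge> 0" "\<kappa>2 \<ge> 0"
  using g_lipschitz by (auto dest: lipschitz_on_nonneg)

lemma g_increment:
  assumes "s \<ge> 0" "t \<ge> 0" "\<bar>s - t\<bar> \<le> d"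
  shows "\<bar>g1 s - g1 t\<bar> \<le> \<kappa>1 * d" "\<bar>g2 s - g2 t\<bar> \<le> \<kappa>2 * d"
proof -
  have "\<bar>g1 s - g1 t\<bar> \<le> \<kappa>1 * \<bar>s - t\<bar>" "\<bar>g2 s - g2 t\<bar> \<le> \<kappa>2 * \<bar>s - t\<bar>"
    using lipschitz_onD[OF g_lipschitz(1), of s t] lipschitz_onD[OF g_lipschitz(2), of s t] assms
    by (auto simp: dist_real_def)
  moreover have "\<kappa>1 * \<bar>s - t\<bar> \<le> \<kappa>1 * d" "\<kappa>2 * \<bar>s - t\<bar> \<le> \<kappa>2 * d"
    using assms \<kappa>_nonneg by (auto intro!: mult_left_mono)
  ultimately show "\<bar>g1 s - g1 t\<bar> \<le> \<kappa>1 * d" "\<bar>g2 s - g2 t\<bar> \<le> \<kappa>2 * d"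
    by linarith+
qed

lemma compartment_lipschitz: "\<exists>L. L-lipschitz_on quadrant compartment"
proof (intro exI lipschitz_onI)
  define c where "c = (\<gamma>1 + V1 * \<kappa>2) + (\<gamma>2 + V2 * \<kappa>1)"
  show "c \<ge> 0" using pos \<kappa>_nonneg by (simp add: c_def)
  fix p q assume pq: "p \<in> quadrant" "q \<in> quadrant"
  have d: "\<bar>fst p - fst q\<bar> \<le> dist p q" "\<bar>snd p - snd q\<bar> \<le> dist p q"
    using dist_fst_le[of p q] dist_snd_le[of p q] by (auto simp: dist_real_def)
  have g: "\<bar>g1 (fst p) - g1 (fst q)\<bar> \<le> \<kappa>1 * dist p q" "\<bar>g2 (snd p) - g2 (snd q)\<bar> \<le> \<kappa>2 * dist p q"
    using pq d by (auto simp: quadrant_def mem_Times_iff intro!: g_increment)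
  have "dist (compartment p) (compartment q) \<le>
      \<bar>fst (compartment p) - fst (compartment q)\<bar> + \<bar>snd (compartment p) - snd (compartment q)\<bar>"
    using norm_Pair_le[of "fst (compartment p) - fst (compartment q)" "snd (compartment p) - snd (compartment q)"]
    by (simp add: dist_norm minus_prod_def)
  also have "\<dots> \<le> (\<gamma>1 + V1 * \<kappa>2) * dist p q + (\<gamma>2 + V2 * \<kappa>1) * dist p q"
    unfolding compartment_field_def fst_conv snd_conv
    using pos d g by (intro add_mono linear_increment) auto
  finally show "dist (compartment p) (compartment q) \<le> c * dist p q"
    by (simp add: c_def algebra_simps)
qed

lemma network_lipschitz: "\<exists>L. L-lipschitz_on orthant network"
proof (intro exI lipschitz_onI)
  define A where "A = (\<Sum>i\<in>UNIV. \<Sum>j\<in>UNIV. a i j * 2)"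
  define c where "c = (\<gamma>1 + V1 * \<kappa>2 + A) + (\<gamma>2 + V2 * \<kappa>1)"
  have A: "A \<ge> 0" using a_nonneg by (auto simp: A_def intro!: sum_nonneg)
  show "real CARD('n) * c \<ge> 0" using pos \<kappa>_nonneg A by (simp add: c_def)
  fix x y :: "(real \<times> real) ^ 'n" assume xy: "x \<in> orthant" "y \<in> orthant"
  let ?D = "dist x y"
  have d: "\<bar>fst (x $ i) - fst (y $ i)\<bar> \<le> ?D" "\<bar>snd (x $ i) - snd (y $ i)\<bar> \<le> ?D" for i
    using abs_component_le[of "x - y" i] by (auto simp: dist_norm)
  have g: "\<bar>g1 (fst (x $ i)) - g1 (fst (y $ i))\<bar> \<le> \<kappa>1 * ?D" "\<bar>g2 (snd (x $ i)) - g2 (snd (y $ i))\<bar> \<le> \<kappa>2 * ?D" for i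
    using xy d[of i] by (auto simp: set_power_def quadrant_def mem_Times_iff intro!: g_increment)
  define S where "S z i = (\<Sum>j\<in>UNIV. a i j * (fst (z $ j) - fst (z $ i)))" for z :: "(real \<times> real) ^ 'n" and i
  have S: "\<bar>S x i - S y i\<bar> \<le> A * ?D" for i
  proof -
    have "\<bar>S x i - S y i\<bar> = \<bar>\<Sum>j\<in>UNIV. a i j * ((fst (x $ j) - fst (y $ j)) - (fst (x $ i) - fst (y $ i)))\<bar>"
      by (simp add: S_def algebra_simps flip: sum_subtractf)
    also have "\<dots> \<le> (\<Sum>j\<in>UNIV. a i j * (2 * ?D))"
    proof (rule order_trans[OF sum_abs], rule sum_mono)
      fix j
      have "\<bar>(fst (x $ j) - fst (y $ j)) - (fst (x $ i) - fst (y $ i))\<bar> \<le> 2 * ?D"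
        using d(1)[of i] d(1)[of j] by linarith
      then show "\<bar>a i j * ((fst (x $ j) - fst (y $ j)) - (fst (x $ i) - fst (y $ i)))\<bar> \<le> a i j * (2 * ?D)"
        using a_nonneg by (simp add: abs_mult mult_left_mono)
    qed
    also have "\<dots> = (\<Sum>j\<in>UNIV. a i j * 2) * ?D" by (simp only: sum_distrib_right mult.assoc)
    also have "\<dots> \<le> A * ?D"
      unfolding A_def using a_nonneg
      by (intro mult_right_mono member_le_sum[of i UNIV "\<lambda>i. \<Sum>j\<in>UNIV. a i j * 2"]) (auto intro!: sum_nonneg)
    finally show ?thesis .
  qed
  have "norm (network x - network y) \<le>
      real CARD('n) * ((\<gamma>1 + V1 * \<kappa>2 + A) * ?D + (\<gamma>2 + V2 * \<kappa>1) * ?D)"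
  proof (rule norm_le_components)
    fix i
    have "\<bar>(- \<gamma>1 * fst (x $ i) + V1 * g2 (snd (x $ i))) - (- \<gamma>1 * fst (y $ i) + V1 * g2 (snd (y $ i)))\<bar>
        \<le> (\<gamma>1 + V1 * \<kappa>2) * ?D"
      using pos d g by (intro linear_increment) auto
    moreover have "fst ((network x - network y) $ i) =
        (- \<gamma>1 * fst (x $ i) + V1 * g2 (snd (x $ i))) - (- \<gamma>1 * fst (y $ i) + V1 * g2 (snd (y $ i)))
        + (S x i - S y i)"
      by (simp add: network_field_def S_def)
    moreover have "(\<gamma>1 + V1 * \<kappa>2 + A) * ?D = (\<gamma>1 + V1 * \<kappa>2) * ?D + A * ?D"
      by (rule distrib_right)
    ultimately show "\<bar>fst ((network x - network y) $ i)\<bar> \<le> (\<gamma>1 + V1 * \<kappa>2 + A) * ?D"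
      using S[of i] by linarith
    have "\<bar>(- \<gamma>2 * snd (x $ i) + V2 * g1 (fst (x $ i))) - (- \<gamma>2 * snd (y $ i) + V2 * g1 (fst (y $ i)))\<bar>
        \<le> (\<gamma>2 + V2 * \<kappa>1) * ?D"
      using pos d g by (intro linear_increment) auto
    then show "\<bar>snd ((network x - network y) $ i)\<bar> \<le> (\<gamma>2 + V2 * \<kappa>1) * ?D"
      by (simp add: network_field_def)
  qed
  also have "\<dots> = real CARD('n) * c * ?D" by (simp only: c_def distrib_right mult.assoc)
  finally show "dist (network x) (network y) \<le> real CARD('n) * c * ?D"
    by (simp only: dist_norm)
qed

text \<open>A box that is invariant for elementary reasons: a bound on one of \<open>g1\<close>, \<open>g2\<close> fixes one side length,
  and the values of the other function on that side fix the other length. It provides solutions of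
  the compartment that start in \<open>state_box b1 b2\<close> before anything is known about the field on
  the faces of this smaller box.\<close>

lemma large_box:
  "\<exists>c1 c2. c1 \<ge> b1 \<and> c2 \<ge> b2 \<and>
     (\<forall>s\<in>{0..c2}. V1 * g2 s \<le> \<gamma>1 * c1) \<and> (\<forall>s\<in>{0..c1}. V2 * g1 s \<le> \<gamma>2 * c2)"
proof -
  have lip_bound: "g1 s \<le> g1 0 + \<kappa>1 * c" "g2 s \<le> g2 0 + \<kappa>2 * c" if "s \<in> {0..c}" for s c
    using g_increment[of s 0 c] that by auto
  have scale: "V * y \<le> \<gamma> * max b (V * B / \<gamma>)" if "y \<le> B" "V > 0" "\<gamma> > 0" for V y \<gamma> b B :: real
  proof -
    have "V * y \<le> \<gamma> * (V * B / \<gamma>)" using that by simp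
    also have "\<dots> \<le> \<gamma> * max b (V * B / \<gamma>)" using that by (intro mult_left_mono) auto
    finally show ?thesis .
  qed
  from g_bounded show ?thesis
  proof
    assume "bounded (g1 ` {0..})"
    then obtain B where "\<forall>y\<in>g1 ` {0..}. norm y \<le> B" unfolding bounded_iff by blast
    then have B: "g1 s \<le> B" if "s \<ge> 0" for s using that by force
    define c2 where "c2 = max b2 (V2 * B / \<gamma>2)"
    define c1 where "c1 = max b1 (V1 * (g2 0 + \<kappa>2 * c2) / \<gamma>1)"
    show ?thesis
      using scale[OF lip_bound(2) pos(3,1)] scale[OF B pos(4,2)]
      by (intro exI[of _ c1] exI[of _ c2]) (auto simp: c1_def c2_def)
  next
    assume "bounded (g2 ` {0..})"
    then obtain B where "\<forall>y\<in>g2 ` {0..}. norm y \<le> B" unfolding bounded_iff by blast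
    then have B: "g2 s \<le> B" if "s \<ge> 0" for s using that by force
    define c1 where "c1 = max b1 (V1 * B / \<gamma>1)"
    define c2 where "c2 = max b2 (V2 * (g1 0 + \<kappa>1 * c1) / \<gamma>2)"
    show ?thesis
      using scale[OF lip_bound(1) pos(4,2)] scale[OF B pos(3,1)]
      by (intro exI[of _ c1] exI[of _ c2]) (auto simp: c1_def c2_def)
  qed
qed

lemma compartment_solution_exists:
  assumes p: "p \<in> state_box b1 b2"
  shows "\<exists>x. solution_on compartment quadrant {0..} x \<and> x 0 = p"
proof -
  obtain c1 c2 where c: "c1 \<ge> b1" "c2 \<ge> b2"
    "\<And>s. s \<in> {0..c2} \<Longrightarrow> V1 * g2 s \<le> \<gamma>1 * c1" "\<And>s. s \<in> {0..c1} \<Longrightarrow> V2 * g1 s \<le> \<gamma>2 * c2"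
    using large_box by blast
  obtain L where L: "L-lipschitz_on quadrant compartment" using compartment_lipschitz by blast
  have sub: "cbox (0, 0) (c1, c2) \<subseteq> quadrant" by (auto simp: cbox_Pair_eq quadrant_def)
  have "\<exists>x. solution_on compartment (cbox (0, 0) (c1, c2)) {0..} x \<and> x 0 = p"
  proof (rule box_solution_exists)
    show "L-lipschitz_on (cbox (0, 0) (c1, c2)) compartment" using L sub by (rule lipschitz_on_subset)
    show "p \<in> cbox (0, 0) (c1, c2)" using p c by (auto simp: state_box_def cbox_Pair_eq)
    show "compartment q \<bullet> i \<ge> 0" if "q \<in> cbox (0, 0) (c1, c2)" "i \<in> Basis" "q \<bullet> i = (0, 0) \<bullet> i" for q i
    proof -
      from that(2) consider "i = (1, 0)" | "i = (0, 1)" by (auto simp: Basis_prod_def)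
      then show ?thesis
        using that(1,3) g_nonneg(1)[of "fst q"] g_nonneg(2)[of "snd q"] pos
        by cases (simp_all add: compartment_field_def cbox_Pair_eq mem_Times_iff inner_prod_def)
    qed
    show "compartment q \<bullet> i \<le> 0" if "q \<in> cbox (0, 0) (c1, c2)" "i \<in> Basis" "q \<bullet> i = (c1, c2) \<bullet> i" for q i
    proof -
      from that(2) consider "i = (1, 0)" | "i = (0, 1)" by (auto simp: Basis_prod_def)
      then show ?thesis
        using that(1,3) c(3)[of "snd q"] c(4)[of "fst q"]
        by cases (simp_all add: compartment_field_def cbox_Pair_eq mem_Times_iff inner_prod_def)
    qed
  qed
  then show ?thesis using solution_on_mono[OF _ sub subset_refl] by blast
qed

text \<open>At a point of a face where the field of a compartment points outwards a solution would leave
  the invariant box.\<close>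

lemma upper_faces:
  shows "s \<in> {0..b2} \<Longrightarrow> V1 * g2 s \<le> \<gamma>1 * b1" and "s \<in> {0..b1} \<Longrightarrow> V2 * g1 s \<le> \<gamma>2 * b2"
proof -
  have face: "compartment p \<bullet> i \<le> 0" if face: "p \<in> state_box b1 b2" "i \<in> Basis" "p \<bullet> i = (b1, b2) \<bullet> i" for p i
  proof -
    obtain x where "solution_on compartment quadrant {0..} x" "x 0 = p"
      using compartment_solution_exists[OF face(1)] by blast
    then show ?thesis
      using invariant_box_face[OF box_invariant[unfolded state_box_cbox], of x p i] face
      by (simp add: state_box_cbox)
  qed
  show "V1 * g2 s \<le> \<gamma>1 * b1" if "s \<in> {0..b2}"
    using face[of "(b1, s)" "(1, 0)"] that pos
    by (auto simp: state_box_def compartment_field_def Basis_prod_def)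
  show "V2 * g1 s \<le> \<gamma>2 * b2" if "s \<in> {0..b1}"
    using face[of "(s, b2)" "(0, 1)"] that pos
    by (auto simp: state_box_def compartment_field_def Basis_prod_def)
qed

lemma box_power_subset: "box_power \<subseteq> orthant"
  by (auto simp: set_power_def state_box_def quadrant_def mem_Times_iff)

lemma box_power_components:
  assumes "x \<in> box_power"
  shows "fst (x $ i) \<in> {0..b1}" "snd (x $ i) \<in> {0..b2}"
  using assms by (auto simp: set_power_def state_box_def mem_Times_iff)

text \<open>Where the first concentration of a compartment is 0 or \<open>b1\<close>, it is the smallest or the largest
  among all compartments, so the coupling pushes it inwards.\<close>

lemma network_solution_exists:
  assumes \<xi>: "\<xi> \<in> box_power"
  shows "\<exists>x. is_the_solution network orthant \<xi> x \<and> solution_on network box_power {0..} x"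
proof -
  obtain L where L: "L-lipschitz_on orthant network" using network_lipschitz by blast
  have "\<exists>x. solution_on network box_power {0..} x \<and> x 0 = \<xi>"
    unfolding set_power_state_box_cbox
  proof (rule box_solution_exists, unfold set_power_state_box_cbox[symmetric])
    show "L-lipschitz_on box_power network" using L box_power_subset by (rule lipschitz_on_subset)
    show "\<xi> \<in> box_power" by (rule \<xi>)
    fix q :: "(real \<times> real) ^ 'n" and i :: "(real \<times> real) ^ 'n"
    assume q: "q \<in> box_power" and "i \<in> Basis"
    then obtain k where "i = axis k (1, 0) \<or> i = axis k (0, 1)"
      by (auto simp: Basis_vec_def Basis_prod_def)
    then consider (fst) "i = axis k (1, 0)" | (snd) "i = axis k (0, 1)" by blast
    note k = this
    have r: "fst (q $ j) \<in> {0..b1}" "snd (q $ j) \<in> {0..b2}" for j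
      using box_power_components[OF q] by auto
    show "network q \<bullet> i \<ge> 0" if "q \<bullet> i = 0 \<bullet> i"
      using k
    proof cases
      case fst
      then have "fst (q $ k) = 0" using that by (simp add: inner_axis inner_prod_def)
      moreover have "(\<Sum>j\<in>UNIV. a k j * (fst (q $ j) - 0)) \<ge> 0"
        using a_nonneg r by (intro sum_nonneg mult_nonneg_nonneg) auto
      ultimately show ?thesis
        using fst g_nonneg(2)[of "snd (q $ k)"] r[of k] pos
        by (simp add: network_field_def inner_axis)
    next
      case snd
      then show ?thesis
        using that g_nonneg(1)[of "fst (q $ k)"] r[of k] pos
        by (simp add: network_field_def inner_axis inner_prod_def)
    qed
    show "network q \<bullet> i \<le> 0" if "q \<bullet> i = (\<chi> i. (b1, b2)) \<bullet> i"
      using k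
    proof cases
      case fst
      then have "fst (q $ k) = b1" using that by (simp add: inner_axis inner_prod_def)
      moreover have "(\<Sum>j\<in>UNIV. a k j * (fst (q $ j) - b1)) \<le> 0"
        using a_nonneg r by (intro sum_nonpos mult_nonneg_nonpos) auto
      ultimately show ?thesis
        using fst upper_faces(1)[of "snd (q $ k)"] r[of k]
        by (simp add: network_field_def inner_axis)
    next
      case snd
      then show ?thesis
        using that upper_faces(2)[of "fst (q $ k)"] r[of k]
        by (simp add: network_field_def inner_axis inner_prod_def)
    qed
  qed
  then obtain x where x: "solution_on network box_power {0..} x" "x 0 = \<xi>" by blast
  have xo: "solution_on network orthant {0..} x"
    using solution_on_mono[OF x(1) box_power_subset subset_refl] .
  moreover have "y t = x t" if "solution_on network orthant {0..T} y" "y 0 = \<xi>" "t \<in> {0..T}" for T y t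
    by (rule solutions_unique[OF L that(1) _ _ that(3)])
      (use that x in \<open>auto intro: solution_on_mono[OF xo]\<close>)
  ultimately show ?thesis using x unfolding is_the_solution_def by blast
qed

section \<open>The Lyapunov function\<close>

text \<open>A compartment whose first concentration is held at \<open>s\<close> brings its second one to
  \<open>V2 / \<gamma>2 * g1 s\<close>.\<close>

definition composite :: "real \<Rightarrow> real" where
  "composite s = g2 (V2 / \<gamma>2 * g1 s)"

text \<open>A formulation of monotonicity that does not depend on its direction.\<close>

lemma g2_order:
  assumes nonneg: "p \<ge> 0" "q \<ge> 0" "r \<ge> 0" and pqr: "(p - q) * (q - r) \<ge> 0"
  shows "(g2 p - g2 q) * (g2 q - g2 r) \<ge> 0"
proof -
  have "(q \<le> p \<and> r \<le> q) \<or> (p \<le> q \<and> q \<le> r)" using pqr by (auto simp: zero_le_mult_iff)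
  moreover have "mono_on {0..} g2 \<or> antimono_on {0..} g2" using g_monotone by blast
  ultimately have "(g2 q \<le> g2 p \<and> g2 r \<le> g2 q) \<or> (g2 p \<le> g2 q \<and> g2 q \<le> g2 r)"
    using nonneg unfolding monotone_on_def by auto
  then show ?thesis by (auto simp: zero_le_mult_iff)
qed

lemma composite_mono: "mono_on {0..b1} composite"
proof (rule mono_onI)
  fix s t assume st: "s \<in> {0..b1}" "t \<in> {0..b1}" "s \<le> t"
  have c: "V2 / \<gamma>2 \<ge> 0" using pos by simp
  have n: "V2 / \<gamma>2 * g1 s \<ge> 0" "V2 / \<gamma>2 * g1 t \<ge> 0"
    using c g_nonneg st by (auto intro!: mult_nonneg_nonneg simp del: times_divide_eq_left)
  from g_monotone show "composite s \<le> composite t"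
  proof
    assume m: "mono_on {0..} g1 \<and> mono_on {0..} g2"
    then have "g1 s \<le> g1 t" using st by (auto intro: mono_onD)
    then have "V2 / \<gamma>2 * g1 s \<le> V2 / \<gamma>2 * g1 t" using c by (rule mult_left_mono)
    then show ?thesis unfolding composite_def using m n by (auto intro: mono_onD)
  next
    assume m: "antimono_on {0..} g1 \<and> antimono_on {0..} g2"
    then have "g1 t \<le> g1 s" using st by (auto simp: monotone_on_def)
    then have "V2 / \<gamma>2 * g1 t \<le> V2 / \<gamma>2 * g1 s" using c by (rule mult_left_mono)
    then show ?thesis unfolding composite_def using m n by (simp add: monotone_on_def)
  qed
qed

lemma composite_continuous: "continuous_on {0..b1} composite"
  unfolding composite_def
proof (rule continuous_on_compose2[OF lipschitz_on_continuous_on[OF g_lipschitz(2)]])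
  show "continuous_on {0..b1} (\<lambda>s. V2 / \<gamma>2 * g1 s)"
    by (intro continuous_intros continuous_on_subset[OF lipschitz_on_continuous_on[OF g_lipschitz(1)]]) auto
  show "(\<lambda>s. V2 / \<gamma>2 * g1 s) ` {0..b1} \<subseteq> {0..}"
    using pos by (auto intro!: divide_nonneg_pos mult_nonneg_nonneg g_nonneg)
qed

text \<open>The increment of the storage term caused by the motion of \<open>v\<close> alone, from \<open>v\<close> to \<open>v'\<close> in time \<open>\<delta>\<close>,
  at fixed \<open>u\<close>; up to second order it is nonpositive. Unless the rate at \<open>v'\<close> is of order
  \<open>\<delta>\<close>, in which case everything is of second order, its sign is the sign of \<open>v' - v\<close>; and it is also
  the sign of \<open>V2 / \<gamma>2 * g1 u - v'\<close>, which is what the subgradient inequality for \<open>\<Psi>\<close> requires.\<close>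

lemma storage_increment:
  assumes \<Psi>: "\<And>y z. \<bar>\<Psi> z - \<Psi> y\<bar> \<le> b1 * \<bar>z - y\<bar>"
      "\<And>u y z. u \<in> {0..b1} \<Longrightarrow> (composite u - z) * (z - y) \<ge> 0 \<Longrightarrow> \<Psi> z - \<Psi> y \<le> u * (z - y)"
    and u: "u \<in> {0..b1}" and v: "v \<ge> 0" "v' \<ge> 0"
    and \<delta>: "\<delta> \<ge> 0" "K \<ge> 0"
    and step: "\<bar>v' - v - \<delta> * (- \<gamma>2 * v' + V2 * g1 u)\<bar> \<le> K * \<delta>\<^sup>2"
  shows "\<Psi> (g2 v') - \<Psi> (g2 v) - u * (g2 v' - g2 v) \<le> 4 * b1 * \<kappa>2 * K * \<delta>\<^sup>2"
proof -
  define w where "w = - \<gamma>2 * v' + V2 * g1 u"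
  have wk: "V2 / \<gamma>2 * g1 u - v' = w / \<gamma>2" using pos by (simp add: w_def field_simps)
  have rhs: "4 * b1 * \<kappa>2 * K * \<delta>\<^sup>2 \<ge> 0" using pos \<kappa>_nonneg \<delta> by simp
  show ?thesis
  proof (cases "\<bar>w\<bar> \<le> K * \<delta>")
    case True
    have "\<bar>\<delta> * w\<bar> \<le> K * \<delta>\<^sup>2"
      using mult_left_mono[OF True \<delta>(1)] \<delta> by (simp add: abs_mult power2_eq_square mult_ac)
    then have "\<bar>v' - v\<bar> \<le> 2 * K * \<delta>\<^sup>2" using step unfolding w_def[symmetric] by linarith
    then have y: "\<bar>g2 v' - g2 v\<bar> \<le> \<kappa>2 * (2 * K * \<delta>\<^sup>2)" using v by (intro g_increment)
    have "\<bar>u * (g2 v' - g2 v)\<bar> \<le> b1 * \<bar>g2 v' - g2 v\<bar>"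
      using u by (auto simp: abs_mult intro!: mult_right_mono)
    moreover have "b1 * \<bar>g2 v' - g2 v\<bar> \<le> b1 * (\<kappa>2 * (2 * K * \<delta>\<^sup>2))"
      using y pos by (intro mult_left_mono) auto
    moreover have "2 * (b1 * (\<kappa>2 * (2 * K * \<delta>\<^sup>2))) = 4 * b1 * \<kappa>2 * K * \<delta>\<^sup>2" by simp
    ultimately show ?thesis using \<Psi>(1)[of "g2 v'" "g2 v"] by linarith
  next
    case False
    have sgn: "w * (v' - v) \<ge> 0"
    proof -
      have "K * \<delta>\<^sup>2 \<le> \<delta> * \<bar>w\<bar>"
        using False mult_left_mono[of "K * \<delta>" "\<bar>w\<bar>" \<delta>] \<delta> by (simp add: power2_eq_square mult_ac)
      then have *: "\<bar>v' - v - \<delta> * w\<bar> \<le> \<delta> * \<bar>w\<bar>" using step unfolding w_def[symmetric] by linarith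
      show ?thesis
      proof (cases "w \<ge> 0")
        case True
        then have "v' - v \<ge> 0" using * by (simp add: abs_le_iff)
        with True show ?thesis by simp
      next
        case False
        then have "v' - v \<le> 0" using * by (simp add: abs_le_iff)
        with False show ?thesis by (simp add: mult_nonpos_nonpos)
      qed
    qed
    have "V2 / \<gamma>2 * g1 u \<ge> 0" using pos g_nonneg(1)[of u] u by simp
    moreover have "(V2 / \<gamma>2 * g1 u - v') * (v' - v) \<ge> 0"
      unfolding wk using sgn pos by simp
    ultimately have "(composite u - g2 v') * (g2 v' - g2 v) \<ge> 0"
      unfolding composite_def using v by (intro g2_order)
    from \<Psi>(2)[OF u this] show ?thesis using rhs by linarith
  qed
qed

lemma network_speed:
  "\<exists>L M. L \<ge> 0 \<and> M \<ge> 0 \<and> L-lipschitz_on box_power network \<and> (\<forall>p\<in>box_power. norm (network p) \<le> M)"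
proof -
  obtain L where "L-lipschitz_on orthant network" using network_lipschitz by blast
  then have L: "L-lipschitz_on box_power network" using box_power_subset by (rule lipschitz_on_subset)
  have "bounded (network ` box_power)"
    by (intro compact_imp_bounded compact_continuous_image lipschitz_on_continuous_on[OF L])
      (simp add: set_power_state_box_cbox)
  then obtain M where "M > 0" "\<forall>p\<in>box_power. norm (network p) \<le> M"
    unfolding bounded_pos by auto
  with L lipschitz_on_nonneg[OF L] show ?thesis by (intro exI[of _ L] exI[of _ M]) simp
qed

text \<open>The Lyapunov argument. In the increment of \<open>W\<close> from \<open>s\<close> to \<open>t\<close> the gradient in \<open>u\<close> is taken at time
  \<open>t\<close>, where convexity of the coupling energy gives an upper bound; the mixed differences
  of \<open>u\<close> and \<open>y = g2 v\<close> are of second order because both factors are Lipschitz in time.\<close>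

lemma first_rates_vanish:
  assumes sol: "solution_on network box_power {0..} x"
  shows "((\<lambda>t. \<Sum>i\<in>UNIV. (fst (network (x t) $ i))\<^sup>2) \<longlongrightarrow> 0) at_top"
proof -
  obtain L M where L: "L \<ge> 0" "L-lipschitz_on box_power network"
    and M: "M \<ge> 0" "\<And>p. p \<in> box_power \<Longrightarrow> norm (network p) \<le> M"
    using network_speed by blast
  obtain \<Psi> where \<Psi>: "\<And>y z. \<bar>\<Psi> z - \<Psi> y\<bar> \<le> b1 * \<bar>z - y\<bar>"
    "\<And>u y z. u \<in> {0..b1} \<Longrightarrow> (composite u - z) * (z - y) \<ge> 0 \<Longrightarrow> \<Psi> z - \<Psi> y \<le> u * (z - y)"
    using conjugate_exists[OF _ composite_continuous composite_mono] pos by fastforce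
  define K where "K = L * M"
  have K: "K \<ge> 0" using L M by (simp add: K_def)
  define u where "u t i = fst (x t $ i)" for t i
  define v where "v t i = snd (x t $ i)" for t i
  define y where "y t i = g2 (v t i)" for t i
  define r where "r t i = fst (network (x t) $ i)" for t i
  define W where "W t = coupling_energy \<gamma>1 a (u t) + (\<Sum>i\<in>UNIV. V1 * (\<Psi> (y t i) - u t i * y t i))" for t
  define c where "c = M * K + V1 * (\<kappa>2 * M * M + 4 * b1 * \<kappa>2 * K)"
  have xb: "x t \<in> box_power" if "t \<ge> 0" for t using sol that by (auto simp: solution_on_def)
  have uv: "u t i \<in> {0..b1}" "v t i \<in> {0..b2}" if "t \<ge> 0" for t i
    using box_power_components[OF xb[OF that]] by (auto simp: u_def v_def)
  have rate1: "\<gamma>1 * u t i - (\<Sum>j\<in>UNIV. a i j * (u t j - u t i)) = V1 * y t i - r t i" for t i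
    by (simp add: r_def u_def y_def v_def network_field_def)
  have rate2: "snd (network (x t) $ i) = - \<gamma>2 * v t i + V2 * g1 (u t i)" for t i
    by (simp add: u_def v_def network_field_def)
  show ?thesis
    unfolding r_def[symmetric]
  proof (rule dissipation_rate_vanishes[of W _ "real CARD('n) * c"])
    fix s t :: real assume st: "0 \<le> s" "s \<le> t"
    then have t0: "0 \<le> t" by simp
    define \<delta> where "\<delta> = t - s"
    have \<delta>: "\<delta> \<ge> 0" using st by (simp add: \<delta>_def)
    note second = solution_second_order[OF sol L(2) M(2) st]
    have inc: "\<bar>u t i - u s i\<bar> \<le> M * \<delta>" "\<bar>v t i - v s i\<bar> \<le> M * \<delta>" for i
      using abs_component_le[of "x t - x s" i] second(1) by (auto simp: u_def v_def \<delta>_def)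
    have rem: "\<bar>u t i - u s i - \<delta> * r t i\<bar> \<le> K * \<delta>\<^sup>2"
        "\<bar>v t i - v s i - \<delta> * (- \<gamma>2 * v t i + V2 * g1 (u t i))\<bar> \<le> K * \<delta>\<^sup>2" for i
      using abs_component_le[of "x t - x s - \<delta> *\<^sub>R network (x t)" i] second(2)[of t] st
      unfolding rate2[symmetric] by (auto simp: u_def v_def r_def \<delta>_def K_def)
    have rM: "\<bar>r t i\<bar> \<le> M" for i
      using abs_component_le(1)[of "network (x t)" i] M(2)[OF xb[OF t0]] by (simp add: r_def)
    have compartmentwise: "(\<gamma>1 * u t i - (\<Sum>j\<in>UNIV. a i j * (u t j - u t i))) * (u t i - u s i)
          + (V1 * (\<Psi> (y t i) - u t i * y t i) - V1 * (\<Psi> (y s i) - u s i * y s i))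
        \<le> - \<delta> * (r t i)\<^sup>2 + c * \<delta>\<^sup>2" for i
    proof -
      have "- r t i * (u t i - u s i) = - \<delta> * (r t i)\<^sup>2 + (- r t i) * (u t i - u s i - \<delta> * r t i)"
        by (simp add: power2_eq_square algebra_simps)
      also have "(- r t i) * (u t i - u s i - \<delta> * r t i) \<le> M * (K * \<delta>\<^sup>2)"
      proof -
        have "(- r t i) * (u t i - u s i - \<delta> * r t i) \<le> \<bar>- r t i\<bar> * \<bar>u t i - u s i - \<delta> * r t i\<bar>"
          by (metis abs_ge_self abs_mult)
        also have "\<dots> \<le> M * (K * \<delta>\<^sup>2)" using rM[of i] rem(1)[of i] M by (intro mult_mono) auto
        finally show ?thesis .
      qed
      finally have A: "- r t i * (u t i - u s i) \<le> - \<delta> * (r t i)\<^sup>2 + M * (K * \<delta>\<^sup>2)" by simp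
      have "\<bar>y t i - y s i\<bar> \<le> \<kappa>2 * (M * \<delta>)"
        unfolding y_def using uv(2)[OF t0, of i] uv(2)[OF st(1), of i] inc(2)[of i] by (intro g_increment) auto
      then have "\<bar>u t i - u s i\<bar> * \<bar>y t i - y s i\<bar> \<le> (M * \<delta>) * (\<kappa>2 * (M * \<delta>))"
        using inc(1)[of i] M \<delta> by (intro mult_mono) auto
      then have B: "(u t i - u s i) * (y t i - y s i) \<le> \<kappa>2 * M * M * \<delta>\<^sup>2"
        using abs_ge_self[of "(u t i - u s i) * (y t i - y s i)"]
        by (simp add: abs_mult power2_eq_square mult_ac)
      have S: "\<Psi> (y t i) - \<Psi> (y s i) - u t i * (y t i - y s i) \<le> 4 * b1 * \<kappa>2 * K * \<delta>\<^sup>2"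
        unfolding y_def using uv[OF t0, of i] uv[OF st(1), of i] \<delta> K rem(2)[of i]
        by (intro storage_increment[OF \<Psi>]) auto
      have "V1 * ((u t i - u s i) * (y t i - y s i) + (\<Psi> (y t i) - \<Psi> (y s i) - u t i * (y t i - y s i)))
          \<le> V1 * (\<kappa>2 * M * M * \<delta>\<^sup>2 + 4 * b1 * \<kappa>2 * K * \<delta>\<^sup>2)"
        using pos B S by (intro mult_left_mono add_mono) auto
      with A show ?thesis unfolding rate1 c_def by (simp add: algebra_simps)
    qed
    have "W t - W s = (coupling_energy \<gamma>1 a (u t) - coupling_energy \<gamma>1 a (u s)) +
        (\<Sum>i\<in>UNIV. V1 * (\<Psi> (y t i) - u t i * y t i) - V1 * (\<Psi> (y s i) - u s i * y s i))"
      by (simp add: W_def sum_subtractf)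
    also have "\<dots> \<le> (\<Sum>i\<in>UNIV. (\<gamma>1 * u t i - (\<Sum>j\<in>UNIV. a i j * (u t j - u t i))) * (u t i - u s i))
        + (\<Sum>i\<in>UNIV. V1 * (\<Psi> (y t i) - u t i * y t i) - V1 * (\<Psi> (y s i) - u s i * y s i))"
      using pos a_nonneg a_sym by (intro add_right_mono coupling_energy_subgradient) auto
    also have "\<dots> \<le> (\<Sum>i\<in>UNIV. - \<delta> * (r t i)\<^sup>2 + c * \<delta>\<^sup>2)"
      unfolding sum.distrib[symmetric] by (intro sum_mono compartmentwise)
    also have "\<dots> = - \<delta> * (\<Sum>i\<in>UNIV. (r t i)\<^sup>2) + real CARD('n) * c * \<delta>\<^sup>2"
      by (simp add: sum.distrib sum_negf sum_subtractf mult_ac flip: sum_distrib_left)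
    finally show "W t - W s \<le> - (t - s) * (\<Sum>i\<in>UNIV. (r t i)\<^sup>2) + real CARD('n) * c * (t - s)\<^sup>2"
      by (simp only: \<delta>_def)
  next
    fix t :: real assume t: "0 \<le> t"
    show "0 \<le> (\<Sum>i\<in>UNIV. (r t i)\<^sup>2)" by (simp add: sum_nonneg)
    have "0 \<le> coupling_energy \<gamma>1 a (u t)"
      unfolding coupling_energy_def using pos a_nonneg by (intro sum_nonneg add_nonneg_nonneg) auto
    \<comment> \<open>A crude lower bound: on \<open>[0, b2]\<close> the value of \<open>g2\<close> differs from \<open>g2 0\<close> by at most \<open>\<kappa>2 * b2\<close>.\<close>
    moreover have "(\<Sum>i\<in>(UNIV::'n set). V1 * (\<Psi> (g2 0) - b1 * (\<kappa>2 * b2) - b1 * (g2 0 + \<kappa>2 * b2)))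
        \<le> (\<Sum>i\<in>UNIV. V1 * (\<Psi> (y t i) - u t i * y t i))"
    proof (intro sum_mono mult_left_mono)
      fix i
      have d: "\<bar>y t i - g2 0\<bar> \<le> \<kappa>2 * b2"
        unfolding y_def using uv(2)[OF t, of i] by (intro g_increment) auto
      have "b1 * \<bar>y t i - g2 0\<bar> \<le> b1 * (\<kappa>2 * b2)" using d pos by (intro mult_left_mono) auto
      then have "\<Psi> (g2 0) - b1 * (\<kappa>2 * b2) \<le> \<Psi> (y t i)" using \<Psi>(1)[of "y t i" "g2 0"] by linarith
      moreover have "y t i \<ge> 0" unfolding y_def using uv(2)[OF t, of i] g_nonneg(2)[of "v t i"] by auto
      then have "u t i * y t i \<le> b1 * (g2 0 + \<kappa>2 * b2)"
        using uv(1)[OF t, of i] d pos by (intro mult_mono) auto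
      ultimately show "\<Psi> (g2 0) - b1 * (\<kappa>2 * b2) - b1 * (g2 0 + \<kappa>2 * b2) \<le> \<Psi> (y t i) - u t i * y t i"
        by linarith
    qed (use pos in auto)
    ultimately show "(\<Sum>i\<in>(UNIV::'n set). V1 * (\<Psi> (g2 0) - b1 * (\<kappa>2 * b2) - b1 * (g2 0 + \<kappa>2 * b2))) \<le> W t"
      by (simp add: W_def)
  qed
qed

text \<open>The rate \<open>w\<close> of \<open>v\<close> changes by \<open>- \<gamma>2 * \<delta> * w\<close> over a time \<open>\<delta>\<close>, up to second order and up to the
  effect of the motion of \<open>u\<close>, which is eventually of second order too because its speed drops
  below \<open>\<delta>\<close>.\<close>

lemma second_rates_vanish:
  assumes sol: "solution_on network box_power {0..} x"
    and first: "((\<lambda>t. fst (network (x t) $ i)) \<longlongrightarrow> 0) at_top"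
  shows "((\<lambda>t. snd (network (x t) $ i)) \<longlongrightarrow> 0) at_top"
proof -
  obtain L M where L: "L \<ge> 0" "L-lipschitz_on box_power network"
    and M: "M \<ge> 0" "\<And>p. p \<in> box_power \<Longrightarrow> norm (network p) \<le> M"
    using network_speed by blast
  define K where "K = L * M"
  have K: "K \<ge> 0" using L M by (simp add: K_def)
  define u where "u t = fst (x t $ i)" for t
  define v where "v t = snd (x t $ i)" for t
  define w where "w t = snd (network (x t) $ i)" for t
  have xb: "x t \<in> box_power" if "t \<ge> 0" for t using sol that by (auto simp: solution_on_def)
  have w: "w t = - \<gamma>2 * v t + V2 * g1 (u t)" for t
    by (simp add: w_def u_def v_def network_field_def)
  have "((\<lambda>t. \<bar>w t\<bar>) \<longlongrightarrow> 0) at_top"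
  proof (rule stable_recursion_vanishes[OF pos(2), of "\<gamma>2 * K + V2 * (\<kappa>1 * (1 + K))" _ M])
    show "0 \<le> \<gamma>2 * K + V2 * (\<kappa>1 * (1 + K))" using pos K \<kappa>_nonneg by simp
    show "\<bar>w t\<bar> \<le> M" if "t \<ge> 0" for t
      using abs_component_le(2)[of "network (x t)" i] M(2)[OF xb[OF that]] by (simp add: w_def)
    fix \<delta> :: real assume \<delta>: "0 < \<delta>" "\<gamma>2 * \<delta> < 1"
    have ev: "\<forall>\<^sub>F t in at_top. \<bar>fst (network (x t) $ i)\<bar> < \<delta>"
      using tendstoD[OF first \<delta>(1)] by simp
    show "\<forall>\<^sub>F t in at_top. \<bar>w (t + \<delta>)\<bar> \<le> (1 - \<gamma>2 * \<delta>) * \<bar>w t\<bar> + (\<gamma>2 * K + V2 * (\<kappa>1 * (1 + K))) * \<delta>\<^sup>2"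
      using ev eventually_ge_at_top[of 0]
    proof eventually_elim
      case (elim t)
      have st: "0 \<le> t" "t \<le> t + \<delta>" using elim \<delta> by auto
      have "norm (x (t + \<delta>) - x t - \<delta> *\<^sub>R network (x t)) \<le> K * \<delta>\<^sup>2"
        using solution_second_order(2)[OF sol L(2) M(2) st, of t] st by (simp add: K_def)
      then have rem: "\<bar>u (t + \<delta>) - u t - \<delta> * fst (network (x t) $ i)\<bar> \<le> K * \<delta>\<^sup>2"
          "\<bar>v (t + \<delta>) - v t - \<delta> * w t\<bar> \<le> K * \<delta>\<^sup>2"
        using abs_component_le[of "x (t + \<delta>) - x t - \<delta> *\<^sub>R network (x t)" i]
        by (auto simp: u_def v_def w_def)
      have "\<bar>\<delta> * fst (network (x t) $ i)\<bar> \<le> \<delta>\<^sup>2"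
        using elim \<delta> by (auto simp: abs_mult power2_eq_square)
      then have du: "\<bar>u (t + \<delta>) - u t\<bar> \<le> (1 + K) * \<delta>\<^sup>2"
        using rem(1) by (simp add: distrib_right) 
      have "\<bar>g1 (u (t + \<delta>)) - g1 (u t)\<bar> \<le> \<kappa>1 * ((1 + K) * \<delta>\<^sup>2)"
        using box_power_components(1)[OF xb[of t], of i] box_power_components(1)[OF xb[of "t + \<delta>"], of i] st du
        by (intro g_increment) (auto simp: u_def)
      then have G: "\<bar>V2 * (g1 (u (t + \<delta>)) - g1 (u t))\<bar> \<le> V2 * (\<kappa>1 * ((1 + K) * \<delta>\<^sup>2))"
        using pos by (simp add: abs_mult)
      have V: "\<bar>\<gamma>2 * (v (t + \<delta>) - v t - \<delta> * w t)\<bar> \<le> \<gamma>2 * (K * \<delta>\<^sup>2)"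
        using pos rem(2) by (simp add: abs_mult)
      have "w (t + \<delta>) = (1 - \<gamma>2 * \<delta>) * w t - \<gamma>2 * (v (t + \<delta>) - v t - \<delta> * w t)
          + V2 * (g1 (u (t + \<delta>)) - g1 (u t))"
        using w[of t] w[of "t + \<delta>"] by (simp add: algebra_simps)
      moreover have "\<bar>(1 - \<gamma>2 * \<delta>) * w t\<bar> = (1 - \<gamma>2 * \<delta>) * \<bar>w t\<bar>" using \<delta> by (simp add: abs_mult)
      ultimately have "\<bar>w (t + \<delta>)\<bar> \<le> (1 - \<gamma>2 * \<delta>) * \<bar>w t\<bar> + \<gamma>2 * (K * \<delta>\<^sup>2) + V2 * (\<kappa>1 * ((1 + K) * \<delta>\<^sup>2))"
        using G V by linarith
      then show ?case by (simp add: algebra_simps)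
    qed
  qed auto
  then show ?thesis unfolding w_def by (rule tendsto_rabs_zero_cancel)
qed

section \<open>Convergence to equilibria\<close>

lemma network_rates_vanish:
  assumes sol: "solution_on network box_power {0..} x"
  shows "((\<lambda>t. network (x t)) \<longlongrightarrow> 0) at_top"
proof -
  have first: "((\<lambda>t. fst (network (x t) $ i)) \<longlongrightarrow> 0) at_top" for i
  proof -
    have "((\<lambda>t. (fst (network (x t) $ i))\<^sup>2) \<longlongrightarrow> 0) at_top"
    proof (rule tendsto_sandwich[OF _ _ tendsto_const first_rates_vanish[OF sol]])
      show "\<forall>\<^sub>F t in at_top. (fst (network (x t) $ i))\<^sup>2 \<le> (\<Sum>i\<in>UNIV. (fst (network (x t) $ i))\<^sup>2)"
        by (intro always_eventually allI member_le_sum[of i UNIV "\<lambda>i. (fst (network (_ t) $ i))\<^sup>2"]) auto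
    qed auto
    then show ?thesis by simp
  qed
  have "((\<lambda>t. (fst (network (x t) $ i), snd (network (x t) $ i))) \<longlongrightarrow> (0, 0)) at_top" for i
    by (intro tendsto_Pair first second_rates_vanish[OF sol])
  then show ?thesis by (intro vec_tendstoI) (simp add: zero_prod_def)
qed

lemma network_trajectories:
  assumes "\<xi> \<in> box_power"
  shows "\<exists>x. is_the_solution network orthant \<xi> x \<and>
    omega_limit_set x \<subseteq> equilibria network box_power \<and>
    ((\<forall>p\<in>equilibria network box_power. p isolated_in equilibria network box_power) \<longrightarrow>
      (\<exists>p\<in>equilibria network box_power. (x \<longlongrightarrow> p) at_top))"
proof -
  obtain x where x: "is_the_solution network orthant \<xi> x" and sol: "solution_on network box_power {0..} x"
    using network_solution_exists[OF assms] by blast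
  obtain L where L: "L-lipschitz_on box_power network" using network_speed by blast
  have cont: "continuous_on box_power network" using L by (rule lipschitz_on_continuous_on)
  have compact: "compact box_power" by (simp add: set_power_state_box_cbox)
  have xb: "x t \<in> box_power" if "t \<ge> 0" for t using sol that by (auto simp: solution_on_def)
  have xc: "continuous_on {0..} x"
    using sol unfolding solution_on_def continuous_on_eq_continuous_within
    by (blast intro: has_vector_derivative_continuous)
  note lim = network_rates_vanish[OF sol]
  show ?thesis
    using x omega_limit_set_equilibria[OF compact_imp_closed[OF compact] cont xb lim]
      converges_if_equilibria_isolated[OF compact cont xb xc lim]
    by (intro exI[of _ x] conjI impI)
qed

end

theorem mainTheorem1:
  fixes \<gamma>1 \<gamma>2 V1 V2 b1 b2 :: real
    and g1 g2 :: "real \<Rightarrow> real"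
    and a :: "'n::finite \<Rightarrow> 'n \<Rightarrow> real"
  defines "f \<equiv> network_field \<gamma>1 \<gamma>2 V1 V2 g1 g2 a"
    and "X \<equiv> (set_power quadrant :: ((real \<times> real) ^ 'n) set)"
    and "BN \<equiv> (set_power (state_box b1 b2) :: ((real \<times> real) ^ 'n) set)"
  assumes "\<gamma>1 > 0" "\<gamma>2 > 0" "V1 > 0" "V2 > 0"
    and "\<And>i j. a i j \<ge> 0"
    and "g1 ` {0..} \<subseteq> {0..}" "g2 ` {0..} \<subseteq> {0..}"
    and "\<exists>L. L-lipschitz_on {0..} g1" "\<exists>L. L-lipschitz_on {0..} g2"
    and "(mono_on {0..} g1 \<and> mono_on {0..} g2) \<or> (antimono_on {0..} g1 \<and> antimono_on {0..} g2)"
    and "bounded (g1 ` {0..}) \<or> bounded (g2 ` {0..})"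
    and "b1 > 0" "b2 > 0"
    and "forward_invariant (compartment_field \<gamma>1 \<gamma>2 V1 V2 g1 g2) quadrant (state_box b1 b2)"
    and "\<And>i j. a i j = a j i"
  shows "(\<forall>\<xi>\<in>BN. \<exists>x. is_the_solution f X \<xi> x \<and> omega_limit_set x \<subseteq> equilibria f BN) \<and>
    ((\<forall>p\<in>equilibria f BN. p isolated_in equilibria f BN) \<longrightarrow>
      (\<forall>\<xi>\<in>BN. \<exists>x. is_the_solution f X \<xi> x \<and> (\<exists>p\<in>equilibria f BN. (x \<longlongrightarrow> p) at_top)))"
proof -
  obtain \<kappa>1 \<kappa>2 where lip: "\<kappa>1-lipschitz_on {0..} g1" "\<kappa>2-lipschitz_on {0..} g2"
    using \<open>\<exists>L. L-lipschitz_on {0..} g1\<close> \<open>\<exists>L. L-lipschitz_on {0..} g2\<close> by blast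
  interpret compartmental_network \<gamma>1 \<gamma>2 V1 V2 b1 b2 \<kappa>1 \<kappa>2 g1 g2 a
  proof unfold_locales
    show "g1 s \<ge> 0" if "s \<ge> 0" for s using \<open>g1 ` {0..} \<subseteq> {0..}\<close> that by auto
    show "g2 s \<ge> 0" if "s \<ge> 0" for s using \<open>g2 ` {0..} \<subseteq> {0..}\<close> that by auto
  qed (fact assms lip)+
  have trajectories: "\<exists>x. is_the_solution f X \<xi> x \<and> omega_limit_set x \<subseteq> equilibria f BN \<and>
      ((\<forall>p\<in>equilibria f BN. p isolated_in equilibria f BN) \<longrightarrow>
        (\<exists>p\<in>equilibria f BN. (x \<longlongrightarrow> p) at_top))" if "\<xi> \<in> BN" for \<xi>
    using that unfolding f_def X_def BN_def by (rule network_trajectories)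
  show ?thesis
  proof (intro conjI ballI impI)
    show "\<exists>x. is_the_solution f X \<xi> x \<and> omega_limit_set x \<subseteq> equilibria f BN" if "\<xi> \<in> BN" for \<xi>
      using trajectories[OF that] by (elim exE conjE) (intro exI conjI)
    show "\<exists>x. is_the_solution f X \<xi> x \<and> (\<exists>p\<in>equilibria f BN. (x \<longlongrightarrow> p) at_top)"
      if "\<forall>p\<in>equilibria f BN. p isolated_in equilibria f BN" and "\<xi> \<in> BN" for \<xi>
      using trajectories[OF that(2)] that(1) by (elim exE conjE) (intro exI conjI, assumption, erule mp)
  qed
qed

end
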